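(* Let $((G_t)_{t=1}^T,(D_t)_{t=1}^T,(\mathcal G_t)_{t=0}^T)$ be a Gaussian model (see context) and, for $t=1,\dots,T$, set $X_t:=g_t^{\mathrm T}G_t$ with nonrandom $g_t\in\mathbb R^n$. For $t=0,\dots,T-1$, let $\rho_t(Z)=\int_0^1F^{-1}_{t,-Z}(u)\,dM(u)$ be quantile-type conditional monetary risk measures (see context) for a common probability distribution $M$, and let $r_0:=\int_0^1\Phi^{-1}(u)\,dM(u)$, where $\Phi$ is the standard normal distribution function. Let $V_T=0$ and, for $t=0,\dots,T-1$, $$V_t=\rho_t(-X_{t+1}-V_{t+1})-\mathbb E^{\mathbb Q}_t\big[(\rho_t(-X_{t+1}-V_{t+1})-X_{t+1}-V_{t+1})_+\big].$$ Then $$V_t=\sum_{s=t+1}^T\mathbb E^{\mathbb Q}_t[X_s]+K^{\mathbb Q}_t=\sum_{s=t+1}^T\mathbb E^{\mathbb P}_t[X_s]+K^{\mathbb P}_t,$$ where, with $e_1$ standard normally distributed with respect to $\mathbb P$, $$K^{\mathbb Q}_t=\sum_{s=t+1}^T\Big(\sigma_sr_0-\sum_{u=s}^Tg_u^{\mathrm T}B_{u,s}\lambda_s-\mathbb E^{\mathbb P}_0\Big[\Big(\sigma_s(r_0-e_1)-\sum_{u=s}^Tg_u^{\mathrm T}B_{u,s}\lambda_s\Big)_+\Big]\Big),$$ $$K^{\mathbb P}_t=\sum_{s=t+1}^T\Big(\sigma_sr_0-\mathbb E^{\mathbb P}_0\Big[\Big(\sigma_s(r_0-e_1)-\sum_{u=s}^Tg_u^{\mathrm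 T}B_{u,s}\lambda_s\Big)_+\Big]\Big),$$ $$\sigma_s^2=\operatorname{Var}^{\mathbb P}_{s-1}\Big(\sum_{u=s}^TX_u\Big)-\operatorname{Var}^{\mathbb P}_s\Big(\sum_{u=s}^TX_u\Big)=\sum_{j=s}^T\sum_{k=s}^Tg_j^{\mathrm T}B_{j,s}B_{k,s}^{\mathrm T}g_k,\qquad\sigma_s\ge0.$$ Moreover, for $t=0,\dots,T-1$, $$C_t:=\rho_t(-X_{t+1}-V_{t+1})-V_t=\mathbb E^{\mathbb P}_0\Big[\Big(\sigma_{t+1}(r_0-e_1)-\sum_{u=t+1}^Tg_u^{\mathrm T}B_{u,t+1}\lambda_{t+1}\Big)_+\Big].$$
   Context: Gaussian model: $T,n\ge1$ are integers and $(\epsilon_t)_{t=1}^T$ is a sequence of independent $n$-dimensional random vectors that are standard normally distributed under $\mathbb P$. For nonrandom $A_t\in\mathbb R^n$ and $B_{t,1},\dots,B_{t,t}\in\mathbb R^{n\times n}$ with $\det(B_{t,t})\ne0$, $t=1,\dots,T$, let $G_t:=A_t+\sum_{s=1}^tB_{t,s}\epsilon_s$. $(\mathcal G_t)_{t=0}^T$ is the filtration generated by $(G_t)_{t=1}^T$, with $\mathcal G_0=\{\emptyset,\Omega\}$ (it equals the filtration generated by $(\epsilon_t)$). For nonrandom $\lambda_t\in\mathbb R^n$, $D_t:=\exp\big\{\sum_{s=1}^t(\lambda_s^{\mathrm T}\epsilon_s-\tfrac12\lambda_s^{\mathrm T}\lambda_s)\big\}$, $D_0=1$, and $\mathbb Q$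 is the probability measure on $\mathcal G_T$ with density $D_T$ with respect to $\mathbb P$, so $\mathbb E^{\mathbb Q}_s[Z]=D_s^{-1}\mathbb E^{\mathbb P}_s[D_tZ]$ for $\mathcal G_t$-measurable $Z$, $s<t$. Subscript $t$ on $\mathbb E^{\mathbb P},\mathbb E^{\mathbb Q},\operatorname{Var}^{\mathbb P}$ means conditioning on $\mathcal G_t$. $(x)_+:=\max(0,x)$; empty sums are $0$; equalities between random variables are almost sure. Quantile-type risk measures: $M$ is a probability distribution on the Borel subsets of $(0,1)$ which either has a bounded density with respect to Lebesgue measure or has support bounded away from $0$ and $1$. For $\mathcal G_{t+1}$-measurable $Z$, $F_{t,-Z}(x):=\mathbb P(-Z\le x\mid\mathcal G_t)$, $F^{-1}_{t,-Z}(u):=\min\{m\in\mathbb R:F_{t,-Z}(m)\ge u\}$, and $\rho_t(Z):=\int_0^1F^{-1}_{t,-Z}(u)\,dM(u)$. *)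

theory Defs
  imports "HOL-Probability.Probability"
begin

definition std_normal_vector :: "'a measure \<Rightarrow> ('a \<Rightarrow> real ^ 'n) \<Rightarrow> bool" where
  "std_normal_vector P Y \<longleftrightarrow>
     distributed P lborel Y (\<lambda>x. ennreal (\<Prod>i\<in>UNIV. std_normal_density (x $ i)))"

text \<open>Only the indices \<open>1 \<le> t \<le> T\<close> of the noise \<open>eps\<close> (and \<open>1 \<le> s \<le> t \<le> T\<close> of
  \<open>B\<close>) matter. The state dimension is \<open>CARD('n)\<close>.\<close>

locale gaussian_model = prob_space P
  for P :: "'a measure" +
  fixes T :: nat
    and eps :: "nat \<Rightarrow> 'a \<Rightarrow> real ^ 'n"
    and B :: "nat \<Rightarrow> nat \<Rightarrow> real ^ 'n ^ 'n"
  assumes T_pos: "1 \<le> T"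
    and eps_indep: "indep_vars (\<lambda>_. borel) eps {1..T}"
    and eps_normal: "\<And>t. t \<in> {1..T} \<Longrightarrow> std_normal_vector P (eps t)"
    and det_nonzero: "\<And>t. t \<in> {1..T} \<Longrightarrow> det (B t t) \<noteq> 0"

definition gauss_process ::
  "(nat \<Rightarrow> real ^ 'n) \<Rightarrow> (nat \<Rightarrow> nat \<Rightarrow> real ^ 'n ^ 'n) \<Rightarrow> (nat \<Rightarrow> 'a \<Rightarrow> real ^ 'n)
     \<Rightarrow> nat \<Rightarrow> 'a \<Rightarrow> real ^ 'n" where
  "gauss_process A B eps t \<omega> = A t + (\<Sum>s=1..t. B t s *v eps s \<omega>)"

definition density_process ::
  "(nat \<Rightarrow> real ^ 'n) \<Rightarrow> (nat \<Rightarrow> 'a \<Rightarrow> real ^ 'n) \<Rightarrow> nat \<Rightarrow> 'a \<Rightarrow> real" where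
  "density_process lam eps t \<omega> =
     exp (\<Sum>s=1..t. (lam s \<bullet> eps s \<omega> - 1/2 * (lam s \<bullet> lam s)))"

text \<open>For \<open>t = 0\<close> the generating family is empty, so the result is the trivial
  \<open>\<sigma>\<close>-algebra \<open>{{}, space P}\<close>. Only the \<open>\<sigma>\<close>-algebra of the measure
  returned here is relevant, not its (zero) measure function.\<close>

definition generated_filtration ::
  "'a measure \<Rightarrow> (nat \<Rightarrow> 'a \<Rightarrow> 'b::topological_space) \<Rightarrow> nat \<Rightarrow> 'a measure" where
  "generated_filtration P Y t =
     sigma (space P) (\<Union>s\<in>{1..t}. {Y s -` S \<inter> space P | S. S \<in> sets borel})"

definition measure_change :: "'a measure \<Rightarrow> 'a measure \<Rightarrow> ('a \<Rightarrow> real) \<Rightarrow> 'a measure" where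
  "measure_change P F D = density (restr_to_subalg P F) (\<lambda>\<omega>. ennreal (D \<omega>))"

definition cond_var :: "'a measure \<Rightarrow> 'a measure \<Rightarrow> ('a \<Rightarrow> real) \<Rightarrow> 'a \<Rightarrow> real" where
  "cond_var P F Y = real_cond_exp P F (\<lambda>\<omega>. (Y \<omega> - real_cond_exp P F Y \<omega>)\<^sup>2)"

text \<open>The conditional distribution function \<open>x \<mapsto> P (Y \<le> x | F)\<close> has to be a genuine
  distribution function for its quantiles to make sense; it is the cdf of a regular conditional
  distribution of \<open>Y\<close> given \<open>F\<close>, of which an arbitrary version is chosen.
  Any two versions agree outside a \<open>P\<close>-null set.\<close>

definition is_reg_cond_distr ::
  "'a measure \<Rightarrow> 'a measure \<Rightarrow> ('a \<Rightarrow> real) \<Rightarrow> ('a \<Rightarrow> real measure) \<Rightarrow> bool" where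
  "is_reg_cond_distr P F Y K \<longleftrightarrow>
     K \<in> measurable F (prob_algebra borel) \<and>
     (\<forall>x. AE \<omega> in P. cdf (K \<omega>) x =
        real_cond_exp P F (indicat_real {\<omega>' \<in> space P. Y \<omega>' \<le> x}) \<omega>)"

definition cond_cdf ::
  "'a measure \<Rightarrow> 'a measure \<Rightarrow> ('a \<Rightarrow> real) \<Rightarrow> 'a \<Rightarrow> real \<Rightarrow> real" where
  "cond_cdf P F Y \<omega> = cdf ((SOME K. is_reg_cond_distr P F Y K) \<omega>)"

definition quantile_fun :: "(real \<Rightarrow> real) \<Rightarrow> real \<Rightarrow> real" where
  "quantile_fun H u = (LEAST m. u \<le> H m)"

definition quantile_risk ::
  "'a measure \<Rightarrow> real measure \<Rightarrow> 'a measure \<Rightarrow> ('a \<Rightarrow> real) \<Rightarrow> 'a \<Rightarrow> real" where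
  "quantile_risk P M F Z \<omega> =
     (\<integral>u. quantile_fun (cond_cdf P F (\<lambda>\<omega>'. - Z \<omega>') \<omega>) u \<partial>M)"

definition unit_interval_support :: "real measure \<Rightarrow> real set" where
  "unit_interval_support M =
     {u \<in> {0<..<1}. \<forall>U. open U \<longrightarrow> u \<in> U \<longrightarrow> 0 < emeasure M (U \<inter> {0<..<1})}"

definition admissible_quantile_weight :: "real measure \<Rightarrow> bool" where
  "admissible_quantile_weight M \<longleftrightarrow>
     prob_space M \<and> space M = {0<..<1} \<and> sets M = sets (restrict_space borel {0<..<1}) \<and>
     ((\<exists>f c. f \<in> borel_measurable borel \<and> (\<forall>u\<in>{0<..<1}. 0 \<le> f u \<and> f u \<le> c) \<and>
         M = density (restrict_space lborel {0<..<1}) (\<lambda>u. ennreal (f u))) \<or>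
      (\<exists>\<delta>>0. unit_interval_support M \<subseteq> {\<delta>..1 - \<delta>}))"

end

theory Submission
  imports Defs
begin

text \<open>
  Put \<open>b\<^sub>s = \<Sum>u=s..T. B\<^sub>u\<^sub>,\<^sub>s\<^sup>T g\<^sub>u\<close> and let \<open>m\<^sub>t\<close> be the conditional mean under \<open>P\<close> of
  \<open>X\<^sub>t\<^sub>+\<^sub>1 + \<dots> + X\<^sub>T\<close> at time \<open>t\<close>. Then \<open>X\<^sub>t\<^sub>+\<^sub>1 + m\<^sub>t\<^sub>+\<^sub>1 = m\<^sub>t + b\<^sub>t\<^sub>+\<^sub>1 \<bullet> eps\<^sub>t\<^sub>+\<^sub>1\<close>,
  so if \<open>V\<^sub>t\<^sub>+\<^sub>1\<close> equals \<open>m\<^sub>t\<^sub>+\<^sub>1\<close> up to a constant, the risk measure is applied to a normal variable of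
  mean \<open>m\<^sub>t\<close> plus a constant and deviation \<open>\<sigma>\<^sub>t\<^sub>+\<^sub>1 = \<parallel>b\<^sub>t\<^sub>+\<^sub>1\<parallel>\<close>: it only adds \<open>\<sigma>\<^sub>t\<^sub>+\<^sub>1 r\<^sub>0\<close>.
  The argument of the positive part is then \<open>\<sigma>\<^sub>t\<^sub>+\<^sub>1 r\<^sub>0 - b\<^sub>t\<^sub>+\<^sub>1 \<bullet> eps\<^sub>t\<^sub>+\<^sub>1\<close>, which is independent of the
  past also under \<open>Q\<close>, where \<open>eps\<^sub>s\<close> has the law of \<open>eps\<^sub>s + \<lambda>\<^sub>s\<close> under \<open>P\<close>; its conditional
  expectation is therefore a constant. Backward induction gives \<open>V\<^sub>t - m\<^sub>t\<close> as a sum of constants.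
\<close>

section \<open>Conditioning on an independent \<open>\<sigma>\<close>-algebra\<close>

lemma (in prob_space) indep_set_mono:
  assumes "indep_set A B" "A' \<subseteq> A" "B' \<subseteq> B"
  shows "indep_set A' B'"
  using assms(1) unfolding indep_set_def
  by (rule indep_sets_mono_sets) (use assms(2,3) in \<open>auto split: bool.split\<close>)

text \<open>The bridge from independent \<sigma>-algebras to product formulas: each variable
  generates a \<sigma>-algebra inside the one it is measurable for, and independence passes to
  smaller families.\<close>

lemma (in prob_space) indep_var_indep_set:
  assumes F: "subalgebra M F" and H: "subalgebra M H"
    and ind: "indep_set (sets F) (sets H)"
    and X: "X \<in> measurable F S" and Y: "Y \<in> measurable H N"
  shows "indep_var S X N Y"
proof -
  have sp: "space F = space M" "space H = space M"
    using F H by (auto simp: subalgebra_def)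
  have "sigma_sets (space M) {X -` A \<inter> space M |A. A \<in> sets S} \<subseteq> sets F"
    using X unfolding sp(1)[symmetric] by (intro sets.sigma_sets_subset) auto
  moreover have "sigma_sets (space M) {Y -` A \<inter> space M |A. A \<in> sets N} \<subseteq> sets H"
    using Y unfolding sp(2)[symmetric] by (intro sets.sigma_sets_subset) auto
  ultimately show ?thesis
    unfolding indep_var_eq
    using indep_set_mono[OF ind] measurable_from_subalg[OF F X] measurable_from_subalg[OF H Y]
    by blast
qed

lemma (in prob_space) sigma_finite_subalgebraI:
  assumes "subalgebra M F"
  shows "sigma_finite_subalgebra M F"
proof -
  interpret finite_measure_subalgebra M F
    by unfold_locales (rule assms)
  show ?thesis by unfold_locales
qed

text \<open>For \<open>A\<close> in \<open>F\<close> the indicator of \<open>A\<close> is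
  independent of \<open>Y\<close>, so the integral of \<open>Y\<close> over \<open>A\<close> factors
  into the probability of \<open>A\<close> times the mean. That is the integral of a constant over
  \<open>A\<close>, which characterises the conditional expectation.\<close>

lemma (in prob_space) real_cond_exp_indep:
  assumes F: "subalgebra M F" and H: "subalgebra M H"
    and ind: "indep_set (sets F) (sets H)"
    and Y: "Y \<in> borel_measurable H" and int: "integrable M Y"
  shows "AE x in M. real_cond_exp M F Y x = expectation Y"
proof -
  interpret sigma_finite_subalgebra M F by (rule sigma_finite_subalgebraI[OF F])
  show ?thesis
  proof (rule real_cond_exp_charact)
    fix A assume A: "A \<in> sets F"
    have AM: "A \<in> sets M" using A F by (auto simp: subalgebra_def)
    have "indep_var borel (indicat_real A) borel Y"
      by (rule indep_var_indep_set[OF F H ind _ Y]) (use A in measurable)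
    then have "(\<integral>x. indicat_real A x * Y x \<partial>M) = (\<integral>x. indicat_real A x \<partial>M) * expectation Y"
      using AM int by (intro indep_var_lebesgue_integral) (auto simp: less_top[symmetric])
    then show "(\<integral>x\<in>A. Y x \<partial>M) = (\<integral>x\<in>A. expectation Y \<partial>M)"
      unfolding set_lebesgue_integral_def using AM by simp
  qed (use int in auto)
qed

lemma (in prob_space) indep_var_nn_integral:
  fixes X Y :: "'a \<Rightarrow> ennreal"
  assumes "indep_var borel X borel Y"
  shows "(\<integral>\<^sup>+\<omega>. X \<omega> * Y \<omega> \<partial>M) = (\<integral>\<^sup>+\<omega>. X \<omega> \<partial>M) * (\<integral>\<^sup>+\<omega>. Y \<omega> \<partial>M)"
proof -
  \<comment> \<open>\<open>indep_var\<close> is phrased with a family of target spaces indexed by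
    \<open>bool\<close>; collapsing it to a constant family makes the product rule for
    \<open>indep_vars\<close> applicable.\<close>
  have "case_bool borel borel = (\<lambda>_. borel :: ennreal measure)"
    by (auto split: bool.split)
  then have "indep_vars (\<lambda>_. borel) (case_bool X Y) UNIV"
    using assms by (simp add: indep_var_def)
  from indep_vars_nn_integral[OF _ this] show ?thesis
    by (simp add: UNIV_bool mult.commute)
qed

lemma (in prob_space) real_cond_exp_add_indep:
  assumes F: "subalgebra M F" and H: "subalgebra M H"
    and ind: "indep_set (sets F) (sets H)"
    and m: "m \<in> borel_measurable F" "integrable M m" and U: "U \<in> borel_measurable H" "integrable M U"
  shows "AE \<omega> in M. real_cond_exp M F (\<lambda>\<omega>. m \<omega> + U \<omega>) \<omega> = m \<omega> + expectation U"
proof -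
  interpret sigma_finite_subalgebra M F by (rule sigma_finite_subalgebraI[OF F])
  show ?thesis
    using real_cond_exp_add[OF m(2) U(2)] real_cond_exp_F_meas[OF m(2,1)] real_cond_exp_indep[OF F H ind U]
    by eventually_elim simp
qed

text \<open>Since \<open>U\<close> is centred, the conditional mean of \<open>Y\<close> is
  \<open>m\<close>, so the residual is \<open>U\<close> almost surely. Its square is again
  measurable for \<open>H\<close>, hence its conditional mean is its plain mean.\<close>

lemma (in prob_space) cond_var_add_indep:
  assumes F: "subalgebra M F" and H: "subalgebra M H"
    and ind: "indep_set (sets F) (sets H)"
    and m: "m \<in> borel_measurable F" "integrable M m"
    and U: "U \<in> borel_measurable H" "integrable M U" "expectation U = 0" "integrable M (\<lambda>\<omega>. (U \<omega>)\<^sup>2)"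
    and Y: "\<And>\<omega>. Y \<omega> = m \<omega> + U \<omega>"
  shows "AE \<omega> in M. cond_var M F Y \<omega> = expectation (\<lambda>\<omega>. (U \<omega>)\<^sup>2)"
proof -
  interpret sigma_finite_subalgebra M F by (rule sigma_finite_subalgebraI[OF F])
  note [measurable] = U(1) m(1) measurable_from_subalg[OF H U(1)] measurable_from_subalg[OF F m(1)]
  have Yeq: "Y = (\<lambda>\<omega>. m \<omega> + U \<omega>)" using Y by (rule ext)
  have "AE \<omega> in M. (Y \<omega> - real_cond_exp M F Y \<omega>)\<^sup>2 = (U \<omega>)\<^sup>2"
    unfolding Yeq using real_cond_exp_add_indep[OF F H ind m U(1,2)] by eventually_elim (simp add: U(3))
  then have "AE \<omega> in M. cond_var M F Y \<omega> = real_cond_exp M F (\<lambda>\<omega>. (U \<omega>)\<^sup>2) \<omega>"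
    unfolding cond_var_def Yeq by (rule real_cond_exp_cong) measurable
  moreover have "AE \<omega> in M. real_cond_exp M F (\<lambda>\<omega>. (U \<omega>)\<^sup>2) \<omega> = expectation (\<lambda>\<omega>. (U \<omega>)\<^sup>2)"
    using U(4) by (intro real_cond_exp_indep[OF F H ind]) measurable
  ultimately show ?thesis by eventually_elim simp
qed

text \<open>The freezing principle: \<open>m \<omega>\<close> is treated as a number while
  \<open>W\<close> is integrated out. Independence makes the joint law a product measure; Fubini
  then reduces the event to the half-line up to \<open>x - m \<omega>\<close>.\<close>

lemma (in prob_space) real_cond_exp_indicat_indep_sum:
  assumes F: "subalgebra M F" and H: "subalgebra M H"
    and ind: "indep_set (sets F) (sets H)"
    and m: "m \<in> borel_measurable F" and W: "W \<in> borel_measurable H"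
  shows "AE \<omega> in M. real_cond_exp M F (indicat_real {\<omega>' \<in> space M. m \<omega>' + W \<omega>' \<le> x}) \<omega> =
           cdf (distr M borel W) (x - m \<omega>)"
proof -
  interpret sigma_finite_subalgebra M F by (rule sigma_finite_subalgebraI[OF F])
  have WM[measurable]: "W \<in> borel_measurable M" by (rule measurable_from_subalg[OF H W])
  have mM[measurable]: "m \<in> borel_measurable M" by (rule measurable_from_subalg[OF F m])
  let ?L = "distr M borel W"
  interpret L: real_distribution ?L
    by (simp add: real_distribution_def real_distribution_axioms_def prob_space_distr)
  interpret C: cdf_distribution ?L by unfold_locales
  \<comment> \<open>The identity, seen as a random variable with values in the space carrying
    \<open>F\<close>, encodes all of \<open>F\<close> in one coordinate. Independence from
    \<open>F\<close> becomes a statement about the law of a pair.\<close>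
  have idF: "(\<lambda>\<omega>. \<omega>) \<in> measurable M F"
    using F by (intro measurable_from_subalg[OF F] measurable_ident_sets) auto
  have jd: "distr M F (\<lambda>\<omega>. \<omega>) \<Otimes>\<^sub>M ?L = distr M (F \<Otimes>\<^sub>M borel) (\<lambda>\<omega>. (\<omega>, W \<omega>))"
  proof (rule pair_measure_eqI)
    show "sigma_finite_measure (distr M F (\<lambda>\<omega>. \<omega>))"
      by (rule prob_space_imp_sigma_finite[OF prob_space_distr[OF idF]])
    show "sigma_finite_measure ?L" by unfold_locales
    show "sets (distr M F (\<lambda>\<omega>. \<omega>) \<Otimes>\<^sub>M ?L) = sets (distr M (F \<Otimes>\<^sub>M borel) (\<lambda>\<omega>. (\<omega>, W \<omega>)))"
      by (simp add: sets_pair_measure_cong[of "distr M F (\<lambda>\<omega>. \<omega>)" F ?L borel])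
    fix A C assume "A \<in> sets (distr M F (\<lambda>\<omega>. \<omega>))" "C \<in> sets ?L"
    then have A: "A \<in> sets F" and C: "C \<in> sets borel" by simp_all
    have A': "A \<subseteq> space M" using sets.sets_into_space[OF A] F by (simp add: subalgebra_def)
    have "W -` C \<inter> space M \<in> sets H"
      using measurable_sets[OF W C] H by (simp add: subalgebra_def)
    then have "prob (A \<inter> (W -` C \<inter> space M)) = prob A * prob (W -` C \<inter> space M)"
      by (rule indep_setD[OF ind A])
    moreover have "(\<lambda>\<omega>. (\<omega>, W \<omega>)) -` (A \<times> C) \<inter> space M = A \<inter> (W -` C \<inter> space M)"
      using A' by auto
    moreover have "(\<lambda>\<omega>. \<omega>) -` A \<inter> space M = A" using A' by auto
    moreover have "random_variable (F \<Otimes>\<^sub>M borel) (\<lambda>\<omega>. (\<omega>, W \<omega>))"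
      using idF by measurable
    ultimately show "emeasure (distr M F (\<lambda>\<omega>. \<omega>)) A * emeasure ?L C
        = emeasure (distr M (F \<Otimes>\<^sub>M borel) (\<lambda>\<omega>. (\<omega>, W \<omega>))) (A \<times> C)"
      using A C idF by (simp add: emeasure_distr emeasure_eq_measure ennreal_mult)
  qed
  show ?thesis
  proof (rule real_cond_exp_charact)
    show int2: "integrable M (\<lambda>\<omega>. cdf ?L (x - m \<omega>))"
      by (rule integrable_const_bound[of _ 1])
        (auto simp: L.cdf_bounded_prob L.cdf_nonneg)
    show "(\<lambda>\<omega>. cdf ?L (x - m \<omega>)) \<in> borel_measurable F"
      using m by measurable
    show "integrable M (indicat_real {\<omega>' \<in> space M. m \<omega>' + W \<omega>' \<le> x})"
      by (auto simp: less_top[symmetric])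
    fix A assume A: "A \<in> sets F"
    have AM[measurable]: "A \<in> sets M" using A F by (auto simp: subalgebra_def)
    have m'[measurable]: "m \<in> borel_measurable F" "A \<in> sets F" by fact+
    let ?S = "{p \<in> space (F \<Otimes>\<^sub>M borel). fst p \<in> A \<and> m (fst p) + snd p \<le> x}"
    have S[measurable]: "?S \<in> sets (F \<Otimes>\<^sub>M borel)" by measurable
    have "ennreal (prob {\<omega>\<in>space M. \<omega> \<in> A \<and> m \<omega> + W \<omega> \<le> x})
        = emeasure (distr M (F \<Otimes>\<^sub>M borel) (\<lambda>\<omega>. (\<omega>, W \<omega>))) ?S"
    proof (subst emeasure_distr)
      show "random_variable (F \<Otimes>\<^sub>M borel) (\<lambda>\<omega>. (\<omega>, W \<omega>))"
        using idF by measurable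
      have "(\<lambda>\<omega>. (\<omega>, W \<omega>)) -` ?S \<inter> space M = {\<omega>\<in>space M. \<omega> \<in> A \<and> m \<omega> + W \<omega> \<le> x}"
        using F by (auto simp: space_pair_measure subalgebra_def)
      then show "ennreal (prob {\<omega>\<in>space M. \<omega> \<in> A \<and> m \<omega> + W \<omega> \<le> x}) =
         emeasure M ((\<lambda>\<omega>. (\<omega>, W \<omega>)) -` ?S \<inter> space M)"
        by (simp add: emeasure_eq_measure)
    qed (rule S)
    also have "\<dots> = emeasure (distr M F (\<lambda>\<omega>. \<omega>) \<Otimes>\<^sub>M ?L) ?S"
      unfolding jd ..
    also have "\<dots> = (\<integral>\<^sup>+\<omega>. emeasure ?L (Pair \<omega> -` ?S) \<partial>distr M F (\<lambda>\<omega>. \<omega>))"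
      by (rule L.emeasure_pair_measure_alt) simp
    also have "\<dots> = (\<integral>\<^sup>+\<omega>. emeasure ?L (Pair \<omega> -` ?S) \<partial>M)"
      by (rule nn_integral_distr[OF idF]) measurable
    also have "\<dots> = (\<integral>\<^sup>+\<omega>. ennreal (indicator A \<omega> * cdf ?L (x - m \<omega>)) \<partial>M)"
    proof (rule nn_integral_cong)
      fix \<omega> assume "\<omega> \<in> space M"
      then have "Pair \<omega> -` ?S = (if \<omega> \<in> A then {..x - m \<omega>} else {})"
        using F by (auto simp: space_pair_measure subalgebra_def)
      then show "emeasure ?L (Pair \<omega> -` ?S) = ennreal (indicator A \<omega> * cdf ?L (x - m \<omega>))"
        by (simp add: cdf_def L.emeasure_eq_measure)
    qed
    also have "\<dots> = ennreal (\<integral>\<omega>. indicator A \<omega> * cdf ?L (x - m \<omega>) \<partial>M)"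
      using integrable_mult_indicator[OF AM int2]
      by (intro nn_integral_eq_integral) (auto simp: L.cdf_nonneg)
    finally have "prob {\<omega>\<in>space M. \<omega> \<in> A \<and> m \<omega> + W \<omega> \<le> x} = (\<integral>\<omega>. indicator A \<omega> * cdf ?L (x - m \<omega>) \<partial>M)"
      by (subst (asm) ennreal_inj) (auto intro!: integral_nonneg_AE simp: L.cdf_nonneg)
    moreover have "(\<integral>\<omega>. indicat_real A \<omega> * indicat_real {\<omega>' \<in> space M. m \<omega>' + W \<omega>' \<le> x} \<omega> \<partial>M)
      = (\<integral>\<omega>. indicat_real {\<omega>\<in>space M. \<omega> \<in> A \<and> m \<omega> + W \<omega> \<le> x} \<omega> \<partial>M)"
      by (rule Bochner_Integration.integral_cong) (auto simp: indicator_def)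
    ultimately show "(\<integral>\<omega>\<in>A. indicat_real {\<omega>' \<in> space M. m \<omega>' + W \<omega>' \<le> x} \<omega> \<partial>M) = (\<integral>\<omega>\<in>A. cdf ?L (x - m \<omega>) \<partial>M)"
      unfolding set_lebesgue_integral_def by simp
  qed
qed

section \<open>Regular conditional distributions: uniqueness, and the kernel of a shifted
  independent variable\<close>

lemma cdf_eq_on_Rats:
  assumes "real_distribution M" "real_distribution N"
    and eq: "\<And>q. q \<in> \<rat> \<Longrightarrow> cdf M q = cdf N q"
  shows "M = N"
proof (rule cdf_unique[OF assms(1,2)], rule ext)
  fix x :: real
  interpret M: real_distribution M by fact
  interpret N: real_distribution N by fact
  \<comment> \<open>The rationals are chosen strictly above \<open>x\<close>, because distribution
    functions are only known to be continuous from the right.\<close>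
  have "\<forall>n. \<exists>q\<in>\<rat>. x < q \<and> q < x + 1 / real (Suc n)"
    by (intro allI Rats_dense_in_real) simp
  then obtain q where q: "\<And>n. q n \<in> \<rat>" "\<And>n. x < q n" "\<And>n. q n < x + 1 / real (Suc n)"
    by metis
  have "q \<longlonglongrightarrow> x"
  proof (rule tendsto_sandwich)
    show "(\<lambda>n. x) \<longlonglongrightarrow> x" by simp
    show "(\<lambda>n. x + 1 / real (Suc n)) \<longlonglongrightarrow> x"
      using tendsto_add[OF tendsto_const[of x] LIMSEQ_inverse_real_of_nat] by (simp add: inverse_eq_divide)
  qed (use q in \<open>auto intro!: always_eventually less_imp_le\<close>)
  then have lim: "filterlim q (at_right x) sequentially"
    using q(2) by (auto simp: filterlim_at less_imp_neq[OF q(2), symmetric])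
  have "(\<lambda>n. cdf M (q n)) \<longlonglongrightarrow> cdf M x"
    using M.cdf_is_right_cont[of x] lim unfolding continuous_within by (rule filterlim_compose)
  moreover have "(\<lambda>n. cdf M (q n)) \<longlonglongrightarrow> cdf N x"
    using N.cdf_is_right_cont[of x] lim unfolding continuous_within eq[OF q(1)] by (rule filterlim_compose)
  ultimately show "cdf M x = cdf N x" by (rule LIMSEQ_unique)
qed

lemma real_distribution_kernel:
  assumes "K \<in> measurable F (prob_algebra borel)" "\<omega> \<in> space F"
  shows "real_distribution (K \<omega>)"
  using measurable_space[OF assms] unfolding space_prob_algebra
  by (auto simp: real_distribution_def real_distribution_axioms_def intro: sets_eq_imp_space_eq[of _ borel, simplified])

text \<open>The defining identity has an exceptional null set for each level. Countably many of
  them, one for each rational level, can be discarded together, and rational levels determine a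
  distribution.\<close>

lemma (in prob_space) is_reg_cond_distr_unique:
  assumes F: "subalgebra M F" and K: "is_reg_cond_distr M F Y K" and L: "is_reg_cond_distr M F Y L"
  shows "AE \<omega> in M. K \<omega> = L \<omega>"
proof -
  have sp: "space F = space M" using F by (simp add: subalgebra_def)
  have "AE \<omega> in M. \<forall>q\<in>\<rat>. cdf (K \<omega>) q = cdf (L \<omega>) q"
  proof (subst AE_ball_countable[OF countable_rat], intro ballI)
    fix q :: real
    have "AE \<omega> in M. cdf (K \<omega>) q = real_cond_exp M F (indicat_real {\<omega>' \<in> space M. Y \<omega>' \<le> q}) \<omega>"
      "AE \<omega> in M. cdf (L \<omega>) q = real_cond_exp M F (indicat_real {\<omega>' \<in> space M. Y \<omega>' \<le> q}) \<omega>"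
      using K L by (auto simp: is_reg_cond_distr_def)
    then show "AE \<omega> in M. cdf (K \<omega>) q = cdf (L \<omega>) q" by eventually_elim simp
  qed
  with AE_space show ?thesis
  proof eventually_elim
    case (elim \<omega>)
    then show ?case
      using K L sp real_distribution_kernel[of K F \<omega>] real_distribution_kernel[of L F \<omega>]
      by (intro cdf_eq_on_Rats) (auto simp: is_reg_cond_distr_def)
  qed
qed

text \<open>By freezing, the conditional law is the law of \<open>W\<close> translated by
  \<open>m \<omega>\<close>. The decomposition of \<open>Y\<close> is only almost sure because the
  recursion determines the value process only almost surely.\<close>

lemma (in prob_space) is_reg_cond_distr_indep_sum:
  assumes F: "subalgebra M F" and H: "subalgebra M H"
    and ind: "indep_set (sets F) (sets H)"
    and m: "m \<in> borel_measurable F" and W: "W \<in> borel_measurable H"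
    and Y: "Y \<in> borel_measurable M" and YmW: "AE \<omega> in M. Y \<omega> = m \<omega> + W \<omega>"
  shows "is_reg_cond_distr M F Y (\<lambda>\<omega>. distr (distr M borel W) borel (\<lambda>x. m \<omega> + x))"
  unfolding is_reg_cond_distr_def
proof (intro conjI allI)
  note [measurable] = m Y measurable_from_subalg[OF H W] measurable_from_subalg[OF F m]
  interpret sigma_finite_subalgebra M F by (rule sigma_finite_subalgebraI[OF F])
  have "distr M borel W \<in> space (prob_algebra borel)"
    by (simp add: space_prob_algebra prob_space_distr)
  then show "(\<lambda>\<omega>. distr (distr M borel W) borel (\<lambda>x. m \<omega> + x)) \<in> F \<rightarrow>\<^sub>M prob_algebra borel"
    by (intro measurable_distr_prob_space2[where M=borel] measurable_const) measurable
  fix x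
  have "AE \<omega> in M. real_cond_exp M F (indicat_real {\<omega>' \<in> space M. Y \<omega>' \<le> x}) \<omega>
     = real_cond_exp M F (indicat_real {\<omega>' \<in> space M. m \<omega>' + W \<omega>' \<le> x}) \<omega>"
    by (rule real_cond_exp_cong) (use YmW in \<open>auto simp: indicator_def\<close>)
  with real_cond_exp_indicat_indep_sum[OF F H ind m W, of x]
  show "AE \<omega> in M. cdf (distr (distr M borel W) borel (\<lambda>x. m \<omega> + x)) x =
     real_cond_exp M F (indicat_real {\<omega>' \<in> space M. Y \<omega>' \<le> x}) \<omega>"
  proof eventually_elim
    case (elim \<omega>)
    have "(\<lambda>y. m \<omega> + y) -` {..x} = {..x - m \<omega>}" by auto
    then show ?case
      unfolding elim by (simp add: cdf_def measure_distr)
  qed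
qed

text \<open>\<open>cond_cdf\<close> uses an arbitrarily chosen kernel. The explicit kernel shows
  that the choice is from a nonempty set, and uniqueness identifies the chosen one outside a null
  set.\<close>

lemma (in prob_space) cond_cdf_indep_sum:
  assumes F: "subalgebra M F" and H: "subalgebra M H"
    and ind: "indep_set (sets F) (sets H)"
    and m: "m \<in> borel_measurable F" and W: "W \<in> borel_measurable H"
    and Y: "Y \<in> borel_measurable M" and YmW: "AE \<omega> in M. Y \<omega> = m \<omega> + W \<omega>"
  shows "AE \<omega> in M. cond_cdf M F Y \<omega> = (\<lambda>x. cdf (distr M borel W) (x - m \<omega>))"
proof -
  note K = is_reg_cond_distr_indep_sum[OF assms]
  note [measurable] = measurable_from_subalg[OF H W]
  show ?thesis
    using is_reg_cond_distr_unique[OF F someI[of "is_reg_cond_distr M F Y", OF K] K]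
  proof eventually_elim
    case (elim \<omega>)
    have "(\<lambda>y. m \<omega> + y) -` {..x} = {..x - m \<omega>}" for x by auto
    then show ?case
      unfolding cond_cdf_def elim by (simp add: cdf_def measure_distr)
  qed
qed

section \<open>Quantile functions and measurability of the conditional risk measure\<close>

lemma quantile_fun_eqI:
  assumes "\<And>x. u \<le> H x \<longleftrightarrow> a \<le> x"
  shows "quantile_fun H u = a"
  unfolding quantile_fun_def by (rule Least_equality) (auto simp: assms)

text \<open>The Galois connection between a distribution function and its quantile function. It
  turns sublevel sets of quantiles into inequalities for the distribution function at one fixed
  level.\<close>

lemma quantile_fun_cdf_le_iff:
  assumes "real_distribution M" "0 < u" "u < 1"
  shows "quantile_fun (cdf M) u \<le> x \<longleftrightarrow> u \<le> cdf M x"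
proof -
  interpret real_distribution M by fact
  interpret cdf_distribution M by unfold_locales
  have "quantile_fun (cdf M) u = I u"
    by (rule quantile_fun_eqI) (rule pseudoinverse[OF assms(2,3)])
  show ?thesis
    unfolding \<open>quantile_fun (cdf M) u = I u\<close> by (rule pseudoinverse[OF assms(2,3), symmetric])
qed

text \<open>The quantile is jointly measurable in \<omega> and the level: by the Galois connection
  its sublevel sets only involve the kernel's distribution function at a fixed point. Integrating
  out the level preserves measurability. Existence of a kernel ensures that the version picked by
  \<open>SOME\<close> is measurable.\<close>

lemma borel_measurable_quantile_risk:
  assumes K: "\<exists>K. is_reg_cond_distr P F (\<lambda>\<omega>. - Z \<omega>) K" and M: "admissible_quantile_weight M"
  shows "quantile_risk P M F Z \<in> borel_measurable F"
proof -
  interpret M: prob_space M using M by (simp add: admissible_quantile_weight_def)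
  define K where "K = (SOME K. is_reg_cond_distr P F (\<lambda>\<omega>. - Z \<omega>) K)"
  have K: "K \<in> measurable F (prob_algebra borel)"
    using someI_ex[OF K] by (simp add: K_def is_reg_cond_distr_def)
  have M_sets: "sets M = sets (restrict_space borel {0<..<1})" and sp: "space M = {0<..<1}"
    using M by (simp_all add: admissible_quantile_weight_def)
  have idM: "(\<lambda>u. u) \<in> borel_measurable M"
    by (subst measurable_cong_sets[OF M_sets refl]) (rule measurable_restrict_space1, simp)
  have cdfK: "(\<lambda>\<omega>. cdf (K \<omega>) x) \<in> borel_measurable F" for x
    unfolding cdf_def using measurable_compose[OF K measurable_measure_prob_algebra[of "{..x}"]] by simp
  have "(\<lambda>(\<omega>, u). quantile_fun (cdf (K \<omega>)) u) \<in> borel_measurable (F \<Otimes>\<^sub>M M)"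
  proof (rule borel_measurableI_le)
    fix x
    note [measurable] = cdfK[of x] idM
    have "{p \<in> space (F \<Otimes>\<^sub>M M). (case p of (\<omega>, u) \<Rightarrow> quantile_fun (cdf (K \<omega>)) u) \<le> x}
      = {p \<in> space (F \<Otimes>\<^sub>M M). snd p \<le> cdf (K (fst p)) x}"
      using K by (auto simp: space_pair_measure sp quantile_fun_cdf_le_iff real_distribution_kernel)
    also have "\<dots> \<in> sets (F \<Otimes>\<^sub>M M)" by measurable
    finally show "{p \<in> space (F \<Otimes>\<^sub>M M). (case p of (\<omega>, u) \<Rightarrow> quantile_fun (cdf (K \<omega>)) u) \<le> x} \<in> sets (F \<Otimes>\<^sub>M M)" .
  qed
  then show ?thesis
    unfolding quantile_risk_def[abs_def] cond_cdf_def K_def[symmetric]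
    by (rule M.borel_measurable_lebesgue_integral)
qed

section \<open>Quantiles of the normal distribution\<close>

lemma std_normal_cdf_distribution: "cdf_distribution std_normal_distribution"
  by (simp add: cdf_distribution_def real_dist_normal_dist)

text \<open>The density is positive everywhere, so an interval of zero normal mass would have zero
  Lebesgue measure.\<close>

lemma strict_mono_cdf_std_normal: "strict_mono (cdf std_normal_distribution)"
proof (rule strict_monoI)
  fix x y :: real assume "x < y"
  interpret real_distribution std_normal_distribution by (rule real_dist_normal_dist)
  have "emeasure std_normal_distribution {x<..y} \<noteq> 0"
  proof
    assume "emeasure std_normal_distribution {x<..y} = 0"
    then have "(\<integral>\<^sup>+z. ennreal (std_normal_density z) * indicator {x<..y} z \<partial>lborel) = 0"
      by (simp add: emeasure_density)
    then have "AE z in lborel. z \<notin> {x<..y}"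
      using normal_density_pos[of 1 0]
      by (subst (asm) nn_integral_0_iff_AE) (auto simp: indicator_def less_le elim!: eventually_mono)
    then have "emeasure lborel {x<..y} = 0"
      using AE_iff_measurable[of "{x<..y}" lborel "\<lambda>z. z \<notin> {x<..y}"]
      by (simp add: greaterThanAtMost_def greaterThan_def atMost_def Collect_conj_eq)
    then show False using \<open>x < y\<close> by simp
  qed
  then have "0 < prob {x<..y}"
    by (simp add: emeasure_eq_measure zero_less_measure_iff)
  then show "cdf std_normal_distribution x < cdf std_normal_distribution y"
    using cdf_diff_eq[OF \<open>x < y\<close>] by simp
qed

text \<open>\<open>inv\<close> is meaningful only at values that are attained. The normal law has no
  atoms, so its distribution function is continuous and attains every level in the open unit
  interval between its tails; strict monotonicity makes the preimage unique.\<close>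

lemma le_cdf_std_normal_iff:
  assumes "0 < u" "u < 1"
  shows "u \<le> cdf std_normal_distribution x \<longleftrightarrow> inv (cdf std_normal_distribution) u \<le> x"
proof -
  let ?C = "cdf std_normal_distribution"
  interpret real_distribution std_normal_distribution by (rule real_dist_normal_dist)
  have cont: "isCont ?C x" for x
  proof -
    have "emeasure std_normal_distribution {x} = 0"
      by (subst emeasure_density) (auto simp: nn_integral_0_iff_AE indicator_def intro: AE_mp[OF AE_lborel_singleton])
    then show ?thesis by (simp add: isCont_cdf measure_def)
  qed
  obtain a where a: "?C a < u"
    by (metis eventually_happens' trivial_limit_at_bot_linorder order_tendstoD(2) cdf_lim_at_bot \<open>0 < u\<close>)
  obtain b where b: "u < ?C b"
    by (metis eventually_happens' trivial_limit_at_top_linorder order_tendstoD(1) cdf_lim_at_top_prob \<open>u < 1\<close>)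
  have "a \<le> b"
    using a b strict_mono_less_eq[OF strict_mono_cdf_std_normal, of b a] by linarith
  then obtain y where y: "?C y = u"
    using IVT[of ?C a u b] a b cont by (metis less_imp_le)
  have "inv ?C u = y"
    unfolding y[symmetric] by (rule inv_f_f[OF strict_mono_imp_inj_on[OF strict_mono_cdf_std_normal]])
  then show ?thesis
    using strict_mono_less_eq[OF strict_mono_cdf_std_normal, of y x] y by simp
qed

lemma quantile_fun_cdf_normal:
  assumes "0 \<le> s" "0 < u" "u < 1"
  shows "quantile_fun (\<lambda>x. cdf (distr std_normal_distribution borel (\<lambda>x. s * x)) (x - m)) u
    = m + s * inv (cdf std_normal_distribution) u"
proof (rule quantile_fun_eqI)
  fix x
  interpret real_distribution std_normal_distribution by (rule real_dist_normal_dist)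
  have "cdf (distr std_normal_distribution borel (\<lambda>x. s * x)) (x - m)
      = measure std_normal_distribution {z. s * z \<le> x - m}"
    by (simp add: cdf_def measure_distr vimage_def)
  moreover have "{z. s * z \<le> x - m} = {..(x - m) / s}" if "s \<noteq> 0"
    using that \<open>0 \<le> s\<close> by (auto simp: field_simps)
  moreover have "(u \<le> cdf std_normal_distribution ((x - m) / s)) = (m + s * inv (cdf std_normal_distribution) u \<le> x)"
    if "s \<noteq> 0"
    unfolding le_cdf_std_normal_iff[OF assms(2,3)] using that \<open>0 \<le> s\<close> by (simp add: field_simps)
  moreover have "measure std_normal_distribution UNIV = 1"
    using prob_space by simp
  ultimately show "u \<le> cdf (distr std_normal_distribution borel (\<lambda>x. s * x)) (x - m)
      \<longleftrightarrow> m + s * inv (cdf std_normal_distribution) u \<le> x"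
    \<comment> \<open>If \<open>s = 0\<close> the law is a point mass, whose distribution function
      is 0 or 1 according to the sign of \<open>x - m\<close>; since \<open>u\<close> lies strictly
      between these values, the quantile is \<open>m\<close>.\<close>
    using assms by (cases "s = 0"; cases "0 \<le> x - m") (auto simp: cdf_def)
qed

text \<open>The points outside the support are covered by open sets of measure zero. By the Lindelof
  property countably many of these already cover them.\<close>

lemma AE_unit_interval_support:
  fixes M :: "real measure"
  assumes sets: "sets M = sets (restrict_space borel {0<..<1})"
  shows "AE u in M. u \<in> unit_interval_support M"
proof -
  have sp: "space M = {0<..<1}"
    using sets_eq_imp_space_eq[OF sets] by (simp add: space_restrict_space)
  define \<F> where "\<F> = {U. open U \<and> emeasure M (U \<inter> {0<..<1::real}) = 0}"
  obtain \<F>' where \<F>': "\<F>' \<subseteq> \<F>" "countable \<F>'" "\<Union>\<F>' = \<Union>\<F>"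
    by (rule Lindelof[of \<F>]) (auto simp: \<F>_def)
  have "U \<inter> {0<..<1} \<in> null_sets M" if "U \<in> \<F>'" for U
  proof -
    have U: "U \<in> sets borel" "emeasure M (U \<inter> {0<..<1}) = 0"
      using that \<F>'(1) by (auto simp: \<F>_def)
    then have "U \<inter> {0<..<1} \<in> sets M"
      unfolding sets sets_restrict_space by (intro image_eqI[of _ _ U]) auto
    with U show ?thesis by (intro null_setsI)
  qed
  then have "(\<Union>U\<in>\<F>'. U \<inter> {0<..<1}) \<in> null_sets M"
    using \<F>'(2) by (intro null_sets_UN') auto
  then have "AE u in M. u \<notin> (\<Union>U\<in>\<F>'. U \<inter> {0<..<1})"
    by (rule AE_not_in)
  with AE_space show ?thesis
  proof eventually_elim
    case (elim u)
    then have "u \<notin> \<Union>\<F>" using \<F>'(3) sp by auto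
    then show ?case
      using elim sp by (auto simp: unit_interval_support_def \<F>_def zero_less_iff_neq_zero)
  qed
qed

text \<open>Both alternatives for the weight make the normal quantile integrable. With a bounded
  density the bound comes from Lebesgue measure, under which the quantile of a uniform level is
  normal; with support away from 0 and 1 the monotone quantile is bounded on the support.\<close>

lemma integrable_inv_cdf_std_normal:
  assumes "admissible_quantile_weight M"
  shows "integrable M (inv (cdf std_normal_distribution))"
proof -
  let ?q = "inv (cdf std_normal_distribution)"
  let ?U = "restrict_space lborel {0<..<1::real}"
  interpret M: prob_space M using assms by (simp add: admissible_quantile_weight_def)
  have sets: "sets M = sets (restrict_space borel {0<..<1})" and sp: "space M = {0<..<1}"
    using assms by (simp_all add: admissible_quantile_weight_def)
  interpret N: cdf_distribution std_normal_distribution by (rule std_normal_cdf_distribution)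
  have q_eq: "N.I u = ?q u" if "u \<in> {0<..<1}" for u
    using that N.pseudoinverse[of u] le_cdf_std_normal_iff[of u]
    by (intro antisym) (metis greaterThanLessThan_iff order_refl)+
  have q_restr: "?q \<in> borel_measurable (restrict_space borel {0<..<1})"
    using N.measurable_CI by (rule measurable_cong[THEN iffD1, rotated]) (simp add: space_restrict_space q_eq)
  then have qM: "?q \<in> borel_measurable M"
    by (simp add: measurable_cong_sets[OF sets refl])
  have setsU: "sets ?U = sets (restrict_space borel {0<..<1})"
    by (rule sets_restrict_space_cong) simp
  have qU: "?q \<in> borel_measurable ?U"
    using q_restr by (simp add: measurable_cong_sets[OF setsU refl])
  have "integrable std_normal_distribution (\<lambda>x. x)"
    using integrable_std_normal_distribution_moment[of 1] by simp
  \<comment> \<open>Quantile transform: Lebesgue measure on the unit interval is mapped by the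
    quantile function to the normal law, so the normal first moment bounds the quantile.\<close>
  then have "integrable (distr ?U borel N.I) (\<lambda>x. x)"
    by (simp add: N.distr_I_eq_M)
  then have "integrable ?U N.I"
    using N.measurable_CI by (subst (asm) integrable_distr_eq) (auto simp: measurable_cong_sets[OF setsU refl])
  then have intU: "integrable ?U ?q"
    by (rule Bochner_Integration.integrable_cong[THEN iffD1, rotated 2]) (auto simp: space_restrict_space q_eq)
  consider f c where "f \<in> borel_measurable borel" "\<forall>u\<in>{0<..<1}. 0 \<le> f u \<and> f u \<le> c"
      "M = density ?U (\<lambda>u. ennreal (f u))"
    | \<delta> where "\<delta> > 0" "unit_interval_support M \<subseteq> {\<delta>..1 - \<delta>}"
    using assms unfolding admissible_quantile_weight_def by blast
  then show ?thesis
  proof cases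
    case 1
    have fU: "f \<in> borel_measurable ?U"
      using 1(1) by (intro measurable_restrict_space1) simp
    have fAE: "AE u in ?U. 0 \<le> f u \<and> f u \<le> c"
      using 1(2) by (intro AE_I2) (simp add: space_restrict_space)
    have "integrable ?U (\<lambda>u. f u *\<^sub>R ?q u)"
    proof (rule Bochner_Integration.integrable_bound)
      show "integrable ?U (\<lambda>u. c * ?q u)" using intU by simp
      show "AE u in ?U. norm (f u *\<^sub>R ?q u) \<le> norm (c * ?q u)"
        using fAE by eventually_elim (auto simp: abs_mult intro: mult_right_mono)
    qed (use fU qU in measurable)
    then show ?thesis
      unfolding 1(3) using fU qU fAE by (subst integrable_density) auto
  next
    case 2
    have AE: "AE u in M. u \<in> {\<delta>..1 - \<delta>}"
      using AE_unit_interval_support[OF sets] by eventually_elim (use 2 in auto)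
    \<comment> \<open>A probability measure cannot be carried by an empty interval, so the interval
      has a point; this forces both of its endpoints to be admissible levels, strictly between 0 and
      1.\<close>
    then obtain u where "u \<in> {\<delta>..1 - \<delta>}"
      using eventually_happens'[OF M.ae_filter_bot AE] by blast
    then have d: "0 < \<delta>" "\<delta> < 1" "1 - \<delta> < 1" "0 < 1 - \<delta>" using 2 by auto
    show ?thesis
    proof (rule M.integrable_const_bound[where B="\<bar>?q \<delta>\<bar> + \<bar>?q (1 - \<delta>)\<bar>"])
      show "AE u in M. norm (?q u) \<le> \<bar>?q \<delta>\<bar> + \<bar>?q (1 - \<delta>)\<bar>"
        using AE AE_space
      proof eventually_elim
        case (elim u)
        then have u: "0 < u" "u < 1" by (auto simp: sp)
        have "mono_on {0<..<1} ?q" using N.mono_I by (simp add: mono_on_def q_eq)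
        then have "?q \<delta> \<le> ?q u" "?q u \<le> ?q (1 - \<delta>)"
          using elim d u by (auto simp: mono_on_def)
        then show ?case unfolding real_norm_def by linarith
      qed
    qed (rule qM)
  qed
qed

text \<open>Given \<open>F\<close>, the loss is normal with mean \<open>m \<omega>\<close> and
  deviation \<open>s\<close>, so each of its quantiles is affine in the standard normal one, and so
  is the weighted integral. Measurability is recorded for the later passage from \<open>P\<close> to
  the new measure.\<close>

lemma (in prob_space) quantile_risk_normal:
  assumes F: "subalgebra M F" and H: "subalgebra M H"
    and ind: "indep_set (sets F) (sets H)"
    and m: "m \<in> borel_measurable F" and W: "W \<in> borel_measurable H"
    and W_law: "distr M borel W = distr std_normal_distribution borel (\<lambda>x. s * x)" and s: "0 \<le> s"
    and Z: "Z \<in> borel_measurable M" and ZmW: "AE \<omega> in M. - Z \<omega> = m \<omega> + W \<omega>"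
    and N: "admissible_quantile_weight N"
  shows "quantile_risk M N F Z \<in> borel_measurable F"
    and "AE \<omega> in M. quantile_risk M N F Z \<omega> =
           m \<omega> + s * (\<integral>u. inv (cdf std_normal_distribution) u \<partial>N)"
proof -
  have Y: "(\<lambda>\<omega>. - Z \<omega>) \<in> borel_measurable M" using Z by measurable
  show "quantile_risk M N F Z \<in> borel_measurable F"
    using is_reg_cond_distr_indep_sum[OF F H ind m W Y ZmW] N by (intro borel_measurable_quantile_risk) blast
  interpret N: prob_space N using N by (simp add: admissible_quantile_weight_def)
  have sp: "space N = {0<..<1}" using N by (simp add: admissible_quantile_weight_def)
  note int = integrable_inv_cdf_std_normal[OF N]
  show "AE \<omega> in M. quantile_risk M N F Z \<omega> =
           m \<omega> + s * (\<integral>u. inv (cdf std_normal_distribution) u \<partial>N)"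
    using cond_cdf_indep_sum[OF F H ind m W Y ZmW]
  proof eventually_elim
    case (elim \<omega>)
    have "quantile_risk M N F Z \<omega> = (\<integral>u. m \<omega> + s * inv (cdf std_normal_distribution) u \<partial>N)"
      unfolding quantile_risk_def elim W_law
      by (rule Bochner_Integration.integral_cong) (auto simp: sp quantile_fun_cdf_normal[OF s])
    also have "\<dots> = m \<omega> + s * (\<integral>u. inv (cdf std_normal_distribution) u \<partial>N)"
      using int by (simp add: N.prob_space)
    finally show ?case .
  qed
qed

section \<open>Standard normal vectors\<close>

text \<open>The product rule for Lebesgue measure is indexed by the basis of the space; the
  coordinate axes reindex it by vector components.\<close>

lemma nn_integral_lborel_prod_vec:
  fixes f :: "'n::finite \<Rightarrow> real \<Rightarrow> ennreal"
  assumes "\<And>i. f i \<in> borel_measurable borel"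
  shows "(\<integral>\<^sup>+x. (\<Prod>i\<in>UNIV. f i ((x::real^'n) $ i)) \<partial>lborel) = (\<Prod>i\<in>UNIV. \<integral>\<^sup>+x. f i x \<partial>lborel)"
proof -
  let ?e = "\<lambda>i::'n. axis i (1::real)"
  have inj: "inj ?e" by (simp add: inj_on_def axis_eq_axis)
  have Basis: "(Basis :: (real^'n) set) = range ?e" by (auto simp: Basis_vec_def)
  have "(\<integral>\<^sup>+x. (\<Prod>b\<in>Basis. f (inv ?e b) ((x::real^'n) \<bullet> b)) \<partial>lborel)
      = (\<Prod>b\<in>Basis. \<integral>\<^sup>+x. f (inv ?e b) x \<partial>lborel)"
    using assms by (intro nn_integral_lborel_prod) auto
  then show ?thesis
    unfolding Basis by (simp add: prod.reindex[OF inj] inv_f_f[OF inj] inner_axis o_def)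
qed

lemma borel_measurable_vec_nth_comp [measurable (raw)]:
  "f \<in> borel_measurable M \<Longrightarrow> (\<lambda>x. (f x :: real^'n) $ i) \<in> borel_measurable M"
  by (rule borel_measurable_continuous_on[of "\<lambda>x. x $ i"]) (auto intro: continuous_intros)

context prob_space
begin

lemma std_normal_vector_nn_integral:
  fixes Y :: "'a \<Rightarrow> real^'n" and f :: "real^'n \<Rightarrow> ennreal"
  assumes "std_normal_vector M Y" and "f \<in> borel_measurable borel"
  shows "(\<integral>\<^sup>+\<omega>. f (Y \<omega>) \<partial>M)
    = (\<integral>\<^sup>+x. ennreal (\<Prod>i\<in>UNIV. std_normal_density (x $ i)) * f x \<partial>lborel)"
  using assms by (subst distributed_nn_integral[symmetric]) (auto simp: std_normal_vector_def)

lemma std_normal_vector_measurable: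
  "std_normal_vector M Y \<Longrightarrow> Y \<in> borel_measurable M"
  by (auto simp: std_normal_vector_def distributed_def)

lemma std_normal_vector_components_prod:
  fixes Y :: "'a \<Rightarrow> real^'n"
  assumes Y: "std_normal_vector M Y" and A: "\<And>i. A i \<in> sets borel"
  shows "emeasure M {\<omega>\<in>space M. \<forall>i. Y \<omega> $ i \<in> A i} = (\<Prod>i\<in>UNIV. emeasure std_normal_distribution (A i))"
proof -
  note [measurable] = std_normal_vector_measurable[OF Y] A
  have "emeasure M {\<omega>\<in>space M. \<forall>i. Y \<omega> $ i \<in> A i}
      = (\<integral>\<^sup>+\<omega>. indicator {\<omega>\<in>space M. \<forall>i. Y \<omega> $ i \<in> A i} \<omega> \<partial>M)"
    by (subst nn_integral_indicator) auto
  also have "\<dots> = (\<integral>\<^sup>+\<omega>. (\<Prod>i\<in>UNIV. indicator (A i) (Y \<omega> $ i)) \<partial>M)"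
  proof (rule nn_integral_cong)
    fix \<omega> assume "\<omega> \<in> space M"
    then show "(indicator {\<omega>\<in>space M. \<forall>i. Y \<omega> $ i \<in> A i} \<omega> :: ennreal) = (\<Prod>i\<in>UNIV. indicator (A i) (Y \<omega> $ i))"
      by (cases "\<forall>i. Y \<omega> $ i \<in> A i") (auto simp: indicator_def)
  qed
  also have "\<dots> = (\<integral>\<^sup>+x. ennreal (\<Prod>i\<in>UNIV. std_normal_density (x $ i)) * (\<Prod>i\<in>UNIV. indicator (A i) (x $ i)) \<partial>lborel)"
    by (rule std_normal_vector_nn_integral[OF Y]) measurable
  also have "\<dots> = (\<integral>\<^sup>+x. (\<Prod>i\<in>UNIV. ennreal (std_normal_density (x $ i)) * indicator (A i) (x $ i)) \<partial>lborel)"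
    by (simp add: prod.distrib prod_ennreal)
  also have "\<dots> = (\<Prod>i\<in>UNIV. \<integral>\<^sup>+x. ennreal (std_normal_density x) * indicator (A i) x \<partial>lborel)"
    by (rule nn_integral_lborel_prod_vec) measurable
  also have "\<dots> = (\<Prod>i\<in>UNIV. emeasure std_normal_distribution (A i))"
    by (intro prod.cong refl) (auto simp: emeasure_density)
  finally show ?thesis .
qed

lemma std_normal_vector_component_law:
  fixes Y :: "'a \<Rightarrow> real^'n"
  assumes Y: "std_normal_vector M Y"
  shows "distr M borel (\<lambda>\<omega>. Y \<omega> $ i) = std_normal_distribution"
proof (rule measure_eqI)
  note [measurable] = std_normal_vector_measurable[OF Y]
  interpret N: real_distribution std_normal_distribution by (rule real_dist_normal_dist)
  fix C :: "real set" assume "C \<in> sets (distr M borel (\<lambda>\<omega>. Y \<omega> $ i))"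
  then have C: "C \<in> sets borel" by simp
  have "emeasure M {\<omega>\<in>space M. \<forall>j. Y \<omega> $ j \<in> (if j = i then C else UNIV)}
      = (\<Prod>j\<in>UNIV. emeasure std_normal_distribution (if j = i then C else UNIV))"
    using C by (intro std_normal_vector_components_prod[OF Y]) auto
  also have "\<dots> = emeasure std_normal_distribution C"
    using N.emeasure_space_1 by (subst prod.remove[of _ i]) auto
  also have "{\<omega>\<in>space M. \<forall>j. Y \<omega> $ j \<in> (if j = i then C else UNIV)} = (\<lambda>\<omega>. Y \<omega> $ i) -` C \<inter> space M"
    by auto
  finally show "emeasure (distr M borel (\<lambda>\<omega>. Y \<omega> $ i)) C = emeasure std_normal_distribution C"
    using C by (simp add: emeasure_distr)
qed simp

text \<open>The joint density is a product, hence probabilities of rectangles factor, and rectangles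
  determine the product measure.\<close>

lemma std_normal_vector_indep_components:
  fixes Y :: "'a \<Rightarrow> real^'n"
  assumes Y: "std_normal_vector M Y"
  shows "indep_vars (\<lambda>_. borel) (\<lambda>i \<omega>. Y \<omega> $ i) UNIV"
proof (subst indep_vars_iff_distr_eq_PiM)
  note [measurable] = std_normal_vector_measurable[OF Y]
  show "random_variable borel (\<lambda>\<omega>. Y \<omega> $ i)" for i by measurable
  interpret N: real_distribution std_normal_distribution by (rule real_dist_normal_dist)
  interpret product_sigma_finite "\<lambda>_::'n. std_normal_distribution"
    by unfold_locales
  show "distr M (Pi\<^sub>M UNIV (\<lambda>_. borel)) (\<lambda>\<omega>. \<lambda>i\<in>UNIV. Y \<omega> $ i) = Pi\<^sub>M UNIV (\<lambda>i. distr M borel (\<lambda>\<omega>. Y \<omega> $ i))"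
    unfolding std_normal_vector_component_law[OF Y]
  proof (rule PiM_eqI)
    show "sets (distr M (Pi\<^sub>M UNIV (\<lambda>_. borel)) (\<lambda>\<omega>. \<lambda>i\<in>UNIV. Y \<omega> $ i)) = sets (Pi\<^sub>M UNIV (\<lambda>_. std_normal_distribution))"
      by (simp cong: sets_PiM_cong)
    fix A :: "'n \<Rightarrow> real set" assume "\<And>i. i \<in> UNIV \<Longrightarrow> A i \<in> sets std_normal_distribution"
    then have A: "A i \<in> sets borel" for i by simp
    have "(\<lambda>\<omega>. \<lambda>i\<in>UNIV. Y \<omega> $ i) -` (Pi\<^sub>E UNIV A) \<inter> space M = {\<omega>\<in>space M. \<forall>i. Y \<omega> $ i \<in> A i}"
      by (auto simp: PiE_iff)
    then show "emeasure (distr M (Pi\<^sub>M UNIV (\<lambda>_. borel)) (\<lambda>\<omega>. \<lambda>i\<in>UNIV. Y \<omega> $ i)) (Pi\<^sub>E UNIV A) =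
        (\<Prod>i\<in>UNIV. emeasure std_normal_distribution (A i))"
      using A std_normal_vector_components_prod[OF Y A]
      by (subst emeasure_distr) (auto intro!: measurable_restrict sets_PiM_I_finite)
  qed simp
qed simp

text \<open>A linear form is a sum of independent scaled normal coordinates whose variances add up
  to the squared norm of \<open>b\<close>.\<close>

lemma std_normal_vector_inner_law:
  fixes Y :: "'a \<Rightarrow> real^'n"
  assumes Y: "std_normal_vector M Y"
  shows "distr M borel (\<lambda>\<omega>. b \<bullet> Y \<omega>) = distr std_normal_distribution borel (\<lambda>x. norm b * x)"
proof (cases "b = 0")
  case True
  interpret N: real_distribution std_normal_distribution by (rule real_dist_normal_dist)
  show ?thesis
    using True by (simp add: distr_const N.distr_const)
next
  case False
  note [measurable] = std_normal_vector_measurable[OF Y]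
  interpret N: real_distribution std_normal_distribution by (rule real_dist_normal_dist)
  \<comment> \<open>A scaled coordinate has a normal density only if its coefficient is nonzero, so
    the vanishing ones are dropped. If all vanish, the law is a point mass, treated separately
    above.\<close>
  define I where "I = {i. b $ i \<noteq> 0}"
  have "I \<noteq> {}" using False by (auto simp: I_def vec_eq_iff)
  have comp: "distributed M lborel (\<lambda>\<omega>. Y \<omega> $ i) std_normal_density" for i
    using std_normal_vector_component_law[OF Y, of i]
    by (auto simp: distributed_def cong: distr_cong)
  have "distributed M lborel (\<lambda>\<omega>. \<Sum>i\<in>I. b $ i * Y \<omega> $ i)
      (normal_density (\<Sum>i\<in>I. 0) (sqrt (\<Sum>i\<in>I. \<bar>b $ i\<bar>\<^sup>2)))"
  proof (rule sum_indep_normal)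
    show "indep_vars (\<lambda>i. borel) (\<lambda>i \<omega>. b $ i * Y \<omega> $ i) I"
      using indep_vars_subset[OF indep_vars_compose2[OF std_normal_vector_indep_components[OF Y],
          of "\<lambda>i x. b $ i * x" "\<lambda>_. borel"]] by simp
    fix i assume "i \<in> I"
    then show "distributed M lborel (\<lambda>\<omega>. b $ i * Y \<omega> $ i) (normal_density 0 \<bar>b $ i\<bar>)"
      using normal_density_affine[OF comp[of i], of "b $ i" 0] by (simp add: I_def)
  qed (use \<open>I \<noteq> {}\<close> in \<open>auto simp: I_def\<close>)
  moreover have "(\<Sum>i\<in>I. b $ i * Y \<omega> $ i) = b \<bullet> Y \<omega>" for \<omega>
    unfolding inner_vec_def I_def by (intro sum.mono_neutral_cong_left) auto
  moreover have "sqrt (\<Sum>i\<in>I. \<bar>b $ i\<bar>\<^sup>2) = norm b"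
    unfolding norm_vec_def L2_set_def I_def
    by (intro arg_cong[where f=sqrt] sum.mono_neutral_cong_left) auto
  ultimately have "distributed M lborel (\<lambda>\<omega>. b \<bullet> Y \<omega>) (normal_density 0 (norm b))"
    by simp
  moreover have "distributed std_normal_distribution lborel (\<lambda>x. norm b * x) (normal_density 0 (norm b))"
  proof -
    have "distributed std_normal_distribution lborel (\<lambda>x. x) std_normal_density"
      by (auto simp: distributed_def distr_id2)
    from N.normal_density_affine[OF this, of "norm b" 0] False show ?thesis by simp
  qed
  ultimately show ?thesis
    by (auto simp: distributed_def cong: distr_cong)
qed

lemma std_normal_vector_inner_integrable:
  fixes Y :: "'a \<Rightarrow> real^'n"
  assumes Y: "std_normal_vector M Y"
  shows "integrable M (\<lambda>\<omega>. b \<bullet> Y \<omega>)" "expectation (\<lambda>\<omega>. b \<bullet> Y \<omega>) = 0"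
    "integrable M (\<lambda>\<omega>. (b \<bullet> Y \<omega>)\<^sup>2)" "expectation (\<lambda>\<omega>. (b \<bullet> Y \<omega>)\<^sup>2) = (norm b)\<^sup>2"
proof -
  note [measurable] = std_normal_vector_measurable[OF Y]
  note law = std_normal_vector_inner_law[OF Y, of b]
  have i1: "integrable std_normal_distribution (\<lambda>x. norm b * x)"
    using integrable_std_normal_distribution_moment[of 1] by simp
  have i2: "integrable std_normal_distribution (\<lambda>x. (norm b * x)\<^sup>2)"
    using integrable_std_normal_distribution_moment[of 2] by (simp add: power_mult_distrib)
  have "integrable (distr M borel (\<lambda>\<omega>. b \<bullet> Y \<omega>)) (\<lambda>x. x)"
    unfolding law by (subst integrable_distr_eq) (use i1 in auto)
  then show "integrable M (\<lambda>\<omega>. b \<bullet> Y \<omega>)"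
    by (subst (asm) integrable_distr_eq) auto
  have "integrable (distr M borel (\<lambda>\<omega>. b \<bullet> Y \<omega>)) (\<lambda>x. x\<^sup>2)"
    unfolding law by (subst integrable_distr_eq) (use i2 in auto)
  then show "integrable M (\<lambda>\<omega>. (b \<bullet> Y \<omega>)\<^sup>2)"
    by (subst (asm) integrable_distr_eq) auto
  have "expectation (\<lambda>\<omega>. b \<bullet> Y \<omega>) = integral\<^sup>L (distr M borel (\<lambda>\<omega>. b \<bullet> Y \<omega>)) (\<lambda>x. x)"
    by (subst integral_distr) auto
  also have "\<dots> = 0"
    unfolding law using integral_std_normal_distribution_moment_odd[of 1] by (subst integral_distr) auto
  finally show "expectation (\<lambda>\<omega>. b \<bullet> Y \<omega>) = 0" .
  have "expectation (\<lambda>\<omega>. (b \<bullet> Y \<omega>)\<^sup>2) = integral\<^sup>L (distr M borel (\<lambda>\<omega>. b \<bullet> Y \<omega>)) (\<lambda>x. x\<^sup>2)"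
    by (subst integral_distr) auto
  also have "\<dots> = (norm b)\<^sup>2"
    unfolding law using std_normal_distribution_even_moments(1)[of 1]
    by (subst integral_distr) (auto simp: power_mult_distrib)
  finally show "expectation (\<lambda>\<omega>. (b \<bullet> Y \<omega>)\<^sup>2) = (norm b)\<^sup>2" .
qed

text \<open>Completing the square in every coordinate: the exponential weight turns the normal
  density at \<open>x\<close> into the density at \<open>x - l\<close>. Translation invariance of
  Lebesgue measure then moves the shift into \<open>f\<close>. This is the source of the drift under
  the new measure.\<close>

lemma std_normal_vector_translation:
  fixes Y :: "'a \<Rightarrow> real^'n" and f :: "real^'n \<Rightarrow> ennreal"
  assumes Y: "std_normal_vector M Y" and f[measurable]: "f \<in> borel_measurable borel"
  shows "(\<integral>\<^sup>+\<omega>. ennreal (exp (l \<bullet> Y \<omega> - 1/2 * (l \<bullet> l))) * f (Y \<omega>) \<partial>M) = (\<integral>\<^sup>+\<omega>. f (Y \<omega> + l) \<partial>M)"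
proof -
  let ?p = "\<lambda>x::real^'n. \<Prod>i\<in>UNIV. std_normal_density (x $ i)"
  have shift: "?p x * exp (l \<bullet> x - 1/2 * (l \<bullet> l)) = ?p (x - l)" for x
  proof -
    have "exp (l \<bullet> x - 1/2 * (l \<bullet> l)) = (\<Prod>i\<in>UNIV. exp (l $ i * x $ i - 1/2 * (l $ i * l $ i)))"
      by (simp add: inner_vec_def exp_sum[symmetric] sum_subtractf sum_divide_distrib)
    then have "?p x * exp (l \<bullet> x - 1/2 * (l \<bullet> l))
        = (\<Prod>i\<in>UNIV. std_normal_density (x $ i) * exp (l $ i * x $ i - 1/2 * (l $ i * l $ i)))"
      by (simp add: prod.distrib)
    also have "\<dots> = ?p (x - l)"
      by (rule prod.cong) (auto simp: std_normal_density_def exp_add[symmetric] power2_eq_square field_simps)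
    finally show ?thesis .
  qed
  have "(\<integral>\<^sup>+\<omega>. ennreal (exp (l \<bullet> Y \<omega> - 1/2 * (l \<bullet> l))) * f (Y \<omega>) \<partial>M)
      = (\<integral>\<^sup>+x. ennreal (?p x) * (ennreal (exp (l \<bullet> x - 1/2 * (l \<bullet> l))) * f x) \<partial>lborel)"
    by (rule std_normal_vector_nn_integral[OF Y]) measurable
  also have "\<dots> = (\<integral>\<^sup>+x. ennreal (?p (x - l)) * f x \<partial>lborel)"
    unfolding shift[symmetric] by (simp add: ennreal_mult prod_nonneg mult.assoc)
  also have "\<dots> = (\<integral>\<^sup>+x. ennreal (?p (x - l)) * f x \<partial>distr lborel borel ((+) l))"
    by (simp add: lborel_distr_plus)
  also have "\<dots> = (\<integral>\<^sup>+x. ennreal (?p x) * f (x + l) \<partial>lborel)"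
    by (subst nn_integral_distr) (auto simp: add.commute)
  also have "\<dots> = (\<integral>\<^sup>+\<omega>. f (Y \<omega> + l) \<partial>M)"
    by (rule std_normal_vector_nn_integral[OF Y, symmetric]) measurable
  finally show ?thesis .
qed

end

section \<open>The Gaussian model and its change of measure\<close>

lemma borel_measurable_matrix_vector_mult [measurable (raw)]:
  fixes C :: "real^'n^'m"
  shows "f \<in> borel_measurable M \<Longrightarrow> (\<lambda>x. C *v f x) \<in> borel_measurable M"
  by (rule borel_measurable_continuous_on[of "\<lambda>x. C *v x"]) (auto intro: matrix_vector_mult_linear_continuous_on)

locale gaussian_market = gaussian_model P T eps B
  for P :: "'a measure" and T :: nat and eps :: "nat \<Rightarrow> 'a \<Rightarrow> real ^ 'n"
    and B :: "nat \<Rightarrow> nat \<Rightarrow> real ^ 'n ^ 'n" +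
  fixes A lam g :: "nat \<Rightarrow> real ^ 'n"
begin

abbreviation G :: "nat \<Rightarrow> 'a \<Rightarrow> real ^ 'n" where
  "G \<equiv> gauss_process A B eps"

abbreviation F :: "nat \<Rightarrow> 'a measure" where
  "F \<equiv> generated_filtration P G"

abbreviation D :: "'a \<Rightarrow> real" where
  "D \<equiv> density_process lam eps T"

abbreviation Q :: "'a measure" where
  "Q \<equiv> measure_change P (F T) D"

section \<open>The filtration of the process compared with the \<sigma>-algebras of the
  noise\<close>

definition noise_algebra :: "nat set \<Rightarrow> 'a measure" where
  "noise_algebra I = vimage_algebra (space P) (\<lambda>\<omega>. \<lambda>i\<in>I. eps i \<omega>) (PiM I (\<lambda>_. borel))"

abbreviation H :: "nat \<Rightarrow> 'a measure" where
  "H t \<equiv> noise_algebra {t+1..T}"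

lemma measurable_eps: "s \<in> {1..T} \<Longrightarrow> eps s \<in> borel_measurable P"
  using eps_indep by (auto simp: indep_vars_def)

lemma space_noise_algebra [simp]: "space (noise_algebra I) = space P"
  by (simp add: noise_algebra_def)

lemma measurable_eps_noise_algebra:
  assumes "s \<in> I" shows "eps s \<in> borel_measurable (noise_algebra I)"
proof -
  have "(\<lambda>\<omega>. \<lambda>i\<in>I. eps i \<omega>) \<in> measurable (noise_algebra I) (PiM I (\<lambda>_. borel))"
    unfolding noise_algebra_def by (rule measurable_vimage_algebra1) (auto simp: space_PiM)
  from measurable_compose[OF this measurable_component_singleton[OF assms]] assms show ?thesis by simp
qed

lemma noise_algebra_subset:
  assumes "space N = space P" "\<And>i. i \<in> I \<Longrightarrow> eps i \<in> borel_measurable N"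
  shows "sets (noise_algebra I) \<subseteq> sets N"
proof -
  have "(\<lambda>\<omega>. \<lambda>i\<in>I. eps i \<omega>) \<in> measurable N (PiM I (\<lambda>_. borel))"
    using assms(2) by (rule measurable_restrict)
  from measurable_sets[OF this] show ?thesis
    unfolding noise_algebra_def assms(1)
    by (subst sets_vimage_algebra2) (auto simp: space_PiM)
qed

lemma noise_algebra_subalgebra:
  assumes "I \<subseteq> {1..T}" shows "subalgebra P (noise_algebra I)"
proof -
  have "sets (noise_algebra I) \<subseteq> sets P"
    using assms by (intro noise_algebra_subset measurable_eps) auto
  then show ?thesis by (simp add: subalgebra_def)
qed

text \<open>Disjoint blocks of an independent family are independent as tuples. The noise
  \<sigma>-algebras are pulled back along exactly these tuples, so their sets are the preimages
  occurring there.\<close>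

lemma indep_noise_algebra:
  assumes "I \<inter> J = {}" "I \<subseteq> {1..T}" "J \<subseteq> {1..T}"
  shows "indep_set (sets (noise_algebra I)) (sets (noise_algebra J))"
proof -
  have sets_eq: "sets (noise_algebra K) = {(\<lambda>\<omega>. \<lambda>i\<in>K. eps i \<omega>) -` S \<inter> space P |S. S \<in> sets (PiM K (\<lambda>_. borel))}" for K
    unfolding noise_algebra_def by (rule sets_vimage_algebra2) (auto simp: space_PiM)
  show ?thesis
    using indep_var_restrict[OF eps_indep assms] unfolding indep_var_eq
    by (elim conjE, elim indep_set_mono) (auto simp: sets_eq)
qed

lemma space_F [simp]: "space (F t) = space P"
  by (simp add: generated_filtration_def space_measure_of_conv)

lemma sets_F: "sets (F t) = sigma_sets (space P) (\<Union>s\<in>{1..t}. {G s -` S \<inter> space P | S. S \<in> sets borel})"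
  unfolding generated_filtration_def by (rule sets_measure_of) auto

lemma measurable_G_F:
  assumes "s \<in> {1..t}" shows "G s \<in> borel_measurable (F t)"
proof (rule measurableI)
  fix S :: "(real^'n) set" assume "S \<in> sets borel"
  then show "G s -` S \<inter> space (F t) \<in> sets (F t)"
    unfolding sets_F space_F using assms by (intro sigma_sets.Basic UN_I[of s]) auto
qed simp

lemma F_subset:
  assumes "space N = space P" "\<And>s. s \<in> {1..t} \<Longrightarrow> G s \<in> borel_measurable N"
  shows "sets (F t) \<subseteq> sets N"
  unfolding sets_F assms(1)[symmetric]
  by (intro sets.sigma_sets_subset UN_least) (use assms(2) in \<open>auto intro: measurable_sets\<close>)

lemma F_mono: "s \<le> t \<Longrightarrow> sets (F s) \<subseteq> sets (F t)"
  by (intro F_subset measurable_G_F) auto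

lemma F_subset_noise_algebra: "sets (F t) \<subseteq> sets (noise_algebra {1..t})"
proof (rule F_subset)
  fix s assume "s \<in> {1..t}"
  then have [measurable]: "eps r \<in> borel_measurable (noise_algebra {1..t})" if "r \<in> {1..s}" for r
    using that by (intro measurable_eps_noise_algebra) auto
  show "G s \<in> borel_measurable (noise_algebra {1..t})"
    unfolding gauss_process_def[abs_def] by measurable
qed simp

lemma F_subalgebra: "t \<le> T \<Longrightarrow> subalgebra P (F t)"
  using F_subset_noise_algebra[of t] noise_algebra_subalgebra[of "{1..t}"] by (auto simp: subalgebra_def)

lemma H_subalgebra: "subalgebra P (H t)"
  by (rule noise_algebra_subalgebra) auto

lemma indep_F_H: "t \<le> T \<Longrightarrow> indep_set (sets (F t)) (sets (H t))"
  by (rule indep_set_mono[OF indep_noise_algebra F_subset_noise_algebra order_refl]) auto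

text \<open>The noise is recovered from the process recursively: once the earlier noise is known,
  subtracting its contribution from \<open>G s\<close> leaves \<open>B s s *v eps s\<close>, and the
  diagonal block is invertible.\<close>

lemma measurable_eps_F: "1 \<le> s \<Longrightarrow> s \<le> t \<Longrightarrow> t \<le> T \<Longrightarrow> eps s \<in> borel_measurable (F t)"
proof (induction s rule: less_induct)
  case (less s)
  have [measurable]: "eps r \<in> borel_measurable (F t)" if "r \<in> {1..<s}" for r
    using that less by auto
  have [measurable]: "G s \<in> borel_measurable (F t)"
    using less by (intro measurable_G_F) auto
  obtain C where inv: "C ** B s s = mat 1"
    using det_nonzero[of s] less.prems unfolding invertible_det_nz[symmetric] invertible_def by auto
  have eq: "eps s \<omega> = C *v (G s \<omega> - A s - (\<Sum>r\<in>{1..<s}. B s r *v eps r \<omega>))" for \<omega>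
  proof -
    have "{1..s} = insert s {1..<s}" using less.prems by auto
    then have "G s \<omega> - A s - (\<Sum>r\<in>{1..<s}. B s r *v eps r \<omega>) = B s s *v eps s \<omega>"
      by (simp add: gauss_process_def)
    then show ?thesis by (simp add: matrix_vector_mul_assoc inv)
  qed
  show ?case unfolding eq[abs_def] by measurable
qed

lemma measurable_eps_H: "s \<in> {t+1..T} \<Longrightarrow> eps s \<in> borel_measurable (H t)"
  by (rule measurable_eps_noise_algebra)

lemma H_subset_F: "sets (H t) \<subseteq> sets (F T)"
  by (rule noise_algebra_subset) (auto intro: measurable_eps_F)

section \<open>The measure \<open>Q\<close>: null sets, independence and the law of the
  noise\<close>

lemma sets_Q [simp]: "sets Q = sets (F T)"
  by (simp add: measure_change_def sets_restr_to_subalg[OF F_subalgebra])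

lemma space_Q [simp]: "space Q = space P"
  by (simp add: measure_change_def space_restr_to_subalg)

lemma F_subalgebra_Q: "t \<le> T \<Longrightarrow> subalgebra Q (F t)"
  using F_mono[of t T] by (simp add: subalgebra_def)

lemma H_subalgebra_Q: "subalgebra Q (H t)"
  using H_subset_F by (simp add: subalgebra_def)

lemma measurable_D: "D \<in> borel_measurable (F T)"
proof -
  have [measurable]: "eps s \<in> borel_measurable (F T)" if "s \<in> {1..T}" for s
    using that by (intro measurable_eps_F) auto
  show ?thesis unfolding density_process_def[abs_def] by measurable
qed

lemma nn_integral_Q:
  assumes f: "f \<in> borel_measurable (F T)"
  shows "(\<integral>\<^sup>+\<omega>. f \<omega> \<partial>Q) = (\<integral>\<^sup>+\<omega>. ennreal (D \<omega>) * f \<omega> \<partial>P)"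
proof -
  note [measurable] = measurable_D f
  have m: "measurable (restr_to_subalg P (F T)) N = measurable (F T) N" for N :: "'b measure"
    by (rule measurable_cong_sets) (simp_all add: sets_restr_to_subalg[OF F_subalgebra])
  have "(\<integral>\<^sup>+\<omega>. f \<omega> \<partial>Q) = (\<integral>\<^sup>+\<omega>. ennreal (D \<omega>) * f \<omega> \<partial>restr_to_subalg P (F T))"
    unfolding measure_change_def by (intro nn_integral_density) (simp_all add: m)
  also have "\<dots> = (\<integral>\<^sup>+\<omega>. ennreal (D \<omega>) * f \<omega> \<partial>P)"
    by (intro nn_integral_subalgebra2[OF F_subalgebra]) auto
  finally show ?thesis .
qed

lemma emeasure_Q:
  assumes "C \<in> sets (F T)"
  shows "emeasure Q C = (\<integral>\<^sup>+\<omega>. ennreal (D \<omega>) * indicator C \<omega> \<partial>P)"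
  using nn_integral_Q[of "indicator C"] assms by simp

text \<open>The density is an exponential, hence positive everywhere, so \<open>Q\<close> has no
  more null sets than \<open>P\<close>.\<close>

lemma AE_Q_imp_AE_P:
  assumes "AE \<omega> in Q. p \<omega>" shows "AE \<omega> in P. p \<omega>"
proof -
  note m = measurable_cong_sets[OF sets_restr_to_subalg[OF F_subalgebra[OF order_refl]] refl]
  have "AE \<omega> in restr_to_subalg P (F T). 0 < ennreal (D \<omega>) \<longrightarrow> p \<omega>"
    using assms measurable_D unfolding measure_change_def by (subst (asm) AE_density) (simp_all add: m)
  then have "AE \<omega> in restr_to_subalg P (F T). p \<omega>"
    by (simp add: density_process_def)
  then show ?thesis by (rule AE_restr_to_subalg[OF F_subalgebra[OF order_refl]])
qed

text \<open>\<open>Q\<close> lives only on \<open>F T\<close>, whereas an exceptional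
  \<open>P\<close>-null set may lie outside that \<sigma>-algebra. Hence the measurability condition
  on the event.\<close>

lemma AE_P_imp_AE_Q:
  assumes p: "{\<omega>\<in>space P. p \<omega>} \<in> sets (F T)" and "AE \<omega> in P. p \<omega>" shows "AE \<omega> in Q. p \<omega>"
proof -
  note m = measurable_cong_sets[OF sets_restr_to_subalg[OF F_subalgebra[OF order_refl]] refl]
  have "AE \<omega> in restr_to_subalg P (F T). p \<omega>"
    using assms by (intro AE_restr_to_subalg2[OF F_subalgebra]) (simp_all add: space_restr_to_subalg sets_restr_to_subalg F_subalgebra pred_def)
  then show ?thesis
    using measurable_D unfolding measure_change_def by (subst AE_density) (auto simp: m)
qed

text \<open>The density is a product of one factor per period and the periods are independent. By
  the translation formula every period other than \<open>s\<close> contributes 1, and period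
  \<open>s\<close> contributes the shifted integral.\<close>

lemma nn_integral_density_eps:
  fixes f :: "real^'n \<Rightarrow> ennreal"
  assumes s: "s \<in> {1..T}" and f[measurable]: "f \<in> borel_measurable borel"
  shows "(\<integral>\<^sup>+\<omega>. ennreal (D \<omega>) * f (eps s \<omega>) \<partial>P) = (\<integral>\<^sup>+\<omega>. f (eps s \<omega> + lam s) \<partial>P)"
proof -
  let ?z = "\<lambda>r x. ennreal (exp (lam r \<bullet> x - 1/2 * (lam r \<bullet> lam r)))"
  let ?f = "\<lambda>r x. ?z r x * (if r = s then f x else 1)"
  have mf: "?f r \<in> borel_measurable borel" for r by (cases "r = s") simp_all
  have "(\<integral>\<^sup>+\<omega>. ennreal (D \<omega>) * f (eps s \<omega>) \<partial>P) = (\<integral>\<^sup>+\<omega>. (\<Prod>r\<in>{1..T}. ?f r (eps r \<omega>)) \<partial>P)"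
  proof (rule nn_integral_cong)
    fix \<omega>
    have "(\<Prod>r\<in>{1..T}. if r = s then f (eps r \<omega>) else 1) = f (eps s \<omega>)"
      using s by (simp add: prod.delta)
    moreover have "ennreal (D \<omega>) = (\<Prod>r\<in>{1..T}. ?z r (eps r \<omega>))"
      by (simp add: density_process_def exp_sum prod_ennreal)
    ultimately show "ennreal (D \<omega>) * f (eps s \<omega>) = (\<Prod>r\<in>{1..T}. ?f r (eps r \<omega>))"
      by (simp add: prod.distrib)
  qed
  also have "\<dots> = (\<Prod>r\<in>{1..T}. \<integral>\<^sup>+\<omega>. ?f r (eps r \<omega>) \<partial>P)"
    using mf by (intro indep_vars_nn_integral indep_vars_compose2[OF eps_indep]) auto
  also have "\<dots> = (\<Prod>r\<in>{1..T}. if r = s then \<integral>\<^sup>+\<omega>. f (eps s \<omega> + lam s) \<partial>P else 1)"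
  proof (rule prod.cong[OF refl])
    fix r assume r: "r \<in> {1..T}"
    have "(\<integral>\<^sup>+\<omega>. ?f r (eps r \<omega>) \<partial>P) = (\<integral>\<^sup>+\<omega>. (if r = s then f (eps r \<omega> + lam r) else 1) \<partial>P)"
      by (rule std_normal_vector_translation[OF eps_normal[OF r]]) simp
    then show "(\<integral>\<^sup>+\<omega>. ?f r (eps r \<omega>) \<partial>P) = (if r = s then \<integral>\<^sup>+\<omega>. f (eps s \<omega> + lam s) \<partial>P else 1)"
      by (cases "r = s") (simp_all add: emeasure_space_1)
  qed
  also have "\<dots> = (\<integral>\<^sup>+\<omega>. f (eps s \<omega> + lam s) \<partial>P)"
    using s by (simp add: prod.delta)
  finally show ?thesis .
qed

lemma prob_space_Q: "prob_space Q"
proof (rule prob_spaceI)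
  have "space P \<in> sets (F T)" using sets.top[of "F T"] by simp
  then have "emeasure Q (space P) = (\<integral>\<^sup>+\<omega>. ennreal (D \<omega>) * indicator (space P) \<omega> \<partial>P)"
    by (rule emeasure_Q)
  also have "\<dots> = (\<integral>\<^sup>+\<omega>. ennreal (D \<omega>) * 1 \<partial>P)"
    by (intro nn_integral_cong) simp
  \<comment> \<open>The constant test function is inserted in period 1, which exists because the
    horizon is at least 1.\<close>
  also have "\<dots> = 1"
    using nn_integral_density_eps[of 1 "\<lambda>_. 1"] T_pos by (simp add: emeasure_space_1)
  finally show "emeasure Q (space Q) = 1" by simp
qed

sublocale Q: prob_space Q by (rule prob_space_Q)

text \<open>The density is a past factor measurable for \<open>F t\<close> times a future factor
  measurable for \<open>H t\<close>. Independence under \<open>P\<close> therefore writes the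
  \<open>Q\<close>-measure of an intersection as a product of a past and a future term.\<close>

lemma Q_indep_F_H:
  assumes t: "t \<le> T"
  shows "Q.indep_set (sets (F t)) (sets (H t))"
proof (rule Q.indep_setI)
  show "sets (F t) \<subseteq> Q.events" using F_mono[OF t] by simp
  show "sets (H t) \<subseteq> Q.events" using H_subset_F by simp
  fix C E assume C: "C \<in> sets (F t)" and E: "E \<in> sets (H t)"
  let ?S = "\<lambda>I \<omega>. exp (\<Sum>s\<in>I. lam s \<bullet> eps s \<omega> - 1/2 * (lam s \<bullet> lam s))"
  have [measurable]: "?S {1..t} \<in> borel_measurable (F t)" "?S {t+1..T} \<in> borel_measurable (H t)"
  proof -
    have [measurable]: "eps s \<in> borel_measurable (F t)" if "s \<in> {1..t}" for s
      using that t by (intro measurable_eps_F) auto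
    have [measurable]: "eps s \<in> borel_measurable (H t)" if "s \<in> {t+1..T}" for s
      using that by (intro measurable_eps_H) auto
    show "?S {1..t} \<in> borel_measurable (F t)" "?S {t+1..T} \<in> borel_measurable (H t)" by measurable
  qed
  have D: "ennreal (D \<omega>) = ennreal (?S {1..t} \<omega>) * ennreal (?S {t+1..T} \<omega>)" for \<omega>
  proof -
    have "{1..T} = {1..t} \<union> {t+1..T}" using t by auto
    then have "(\<Sum>s\<in>{1..T}. lam s \<bullet> eps s \<omega> - 1/2 * (lam s \<bullet> lam s)) =
      (\<Sum>s\<in>{1..t}. lam s \<bullet> eps s \<omega> - 1/2 * (lam s \<bullet> lam s)) + (\<Sum>s\<in>{t+1..T}. lam s \<bullet> eps s \<omega> - 1/2 * (lam s \<bullet> lam s))"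
      by (simp only:) (rule sum.union_disjoint, auto)
    then show ?thesis by (simp add: density_process_def exp_add ennreal_mult)
  qed
  have split: "emeasure Q (C' \<inter> E') = (\<integral>\<^sup>+\<omega>. ennreal (?S {1..t} \<omega>) * indicator C' \<omega> \<partial>P) *
      (\<integral>\<^sup>+\<omega>. ennreal (?S {t+1..T} \<omega>) * indicator E' \<omega> \<partial>P)"
    if [measurable]: "C' \<in> sets (F t)" "E' \<in> sets (H t)" for C' E'
  proof -
    have "emeasure Q (C' \<inter> E') = (\<integral>\<^sup>+\<omega>. ennreal (D \<omega>) * indicator (C' \<inter> E') \<omega> \<partial>P)"
      using F_mono[OF t] H_subset_F that by (intro emeasure_Q sets.Int) auto
    also have "\<dots> = (\<integral>\<^sup>+\<omega>. (ennreal (?S {1..t} \<omega>) * indicator C' \<omega>) * (ennreal (?S {t+1..T} \<omega>) * indicator E' \<omega>) \<partial>P)"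
      by (intro nn_integral_cong) (simp add: D indicator_inter_arith mult_ac)
    also have "\<dots> = (\<integral>\<^sup>+\<omega>. ennreal (?S {1..t} \<omega>) * indicator C' \<omega> \<partial>P) *
      (\<integral>\<^sup>+\<omega>. ennreal (?S {t+1..T} \<omega>) * indicator E' \<omega> \<partial>P)"
      by (intro indep_var_nn_integral indep_var_indep_set[OF F_subalgebra[OF t] H_subalgebra indep_F_H[OF t]]) measurable
    finally show ?thesis .
  qed
  have sp: "space P \<in> sets (F t)" "space P \<in> sets (H t)"
    using sets.top[of "F t"] sets.top[of "H t"] by simp_all
  have sub: "C \<subseteq> space P" "E \<subseteq> space P"
    using sets.sets_into_space[OF C] sets.sets_into_space[OF E] by simp_all
  \<comment> \<open>Both sides are the same product of four factors. Comparing with the whole space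
    normalises the two terms without computing the mass of either factor separately.\<close>
  have "emeasure Q (C \<inter> E) * emeasure Q (space P \<inter> space P) = emeasure Q (C \<inter> space P) * emeasure Q (space P \<inter> E)"
    by (simp only: split C E sp) (simp add: mult_ac)
  then have "emeasure Q (C \<inter> E) = emeasure Q C * emeasure Q E"
    using Q.emeasure_space_1 sub by (simp add: Int_absorb1 Int_absorb2)
  then show "Q.prob (C \<inter> E) = Q.prob C * Q.prob E"
    by (simp add: measure_def enn2real_mult)
qed

lemma distr_Q_eps:
  assumes s: "s \<in> {1..T}"
  shows "distr Q borel (eps s) = distr P borel (\<lambda>\<omega>. eps s \<omega> + lam s)"
proof (rule measure_eqI)
  have mF: "eps s \<in> borel_measurable (F T)" using s by (intro measurable_eps_F) auto
  then have mQ: "eps s \<in> borel_measurable Q" by (simp add: measurable_cong_sets[OF sets_Q refl])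
  note [measurable] = mF measurable_eps[OF s]
  fix C assume "C \<in> sets (distr Q borel (eps s))"
  then have C[measurable]: "C \<in> sets borel" by simp
  have "emeasure (distr Q borel (eps s)) C = (\<integral>\<^sup>+\<omega>. indicator C (eps s \<omega>) \<partial>Q)"
    using nn_integral_distr[OF mQ, of "indicator C"] C by simp
  also have "\<dots> = (\<integral>\<^sup>+\<omega>. indicator C (eps s \<omega> + lam s) \<partial>P)"
    by (subst nn_integral_Q) (simp_all add: nn_integral_density_eps[OF s])
  also have "\<dots> = emeasure (distr P borel (\<lambda>\<omega>. eps s \<omega> + lam s)) C"
    using nn_integral_distr[of "\<lambda>\<omega>. eps s \<omega> + lam s" P borel "indicator C"] C by simp
  finally show "emeasure (distr Q borel (eps s)) C = emeasure (distr P borel (\<lambda>\<omega>. eps s \<omega> + lam s)) C" .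
qed simp

lemma Q_eps:
  fixes f :: "real^'n \<Rightarrow> real"
  assumes s: "s \<in> {1..T}" and f: "f \<in> borel_measurable borel"
  shows "integrable Q (\<lambda>\<omega>. f (eps s \<omega>)) \<longleftrightarrow> integrable P (\<lambda>\<omega>. f (eps s \<omega> + lam s))"
    and "Q.expectation (\<lambda>\<omega>. f (eps s \<omega>)) = expectation (\<lambda>\<omega>. f (eps s \<omega> + lam s))"
proof -
  have mQ: "eps s \<in> borel_measurable Q"
    using s by (simp add: measurable_cong_sets[OF sets_Q refl] measurable_eps_F)
  note [measurable] = measurable_eps[OF s]
  have mP: "(\<lambda>\<omega>. eps s \<omega> + lam s) \<in> borel_measurable P" by measurable
  show "integrable Q (\<lambda>\<omega>. f (eps s \<omega>)) \<longleftrightarrow> integrable P (\<lambda>\<omega>. f (eps s \<omega> + lam s))"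
    using integrable_distr_eq[OF mQ f] integrable_distr_eq[OF mP f] distr_Q_eps[OF s] by simp
  show "Q.expectation (\<lambda>\<omega>. f (eps s \<omega>)) = expectation (\<lambda>\<omega>. f (eps s \<omega> + lam s))"
    using integral_distr[OF mQ f] integral_distr[OF mP f] distr_Q_eps[OF s] by simp
qed


section \<open>Payoffs and the backward recursion\<close>

abbreviation X :: "nat \<Rightarrow> 'a \<Rightarrow> real" where
  "X \<equiv> \<lambda>t \<omega>. g t \<bullet> G t \<omega>"

text \<open>For \<open>t \<le> s\<close> this is the \<open>P\<close>-conditional mean of
  \<open>X s\<close> at time \<open>t\<close>: the later, centred noise is simply removed from the
  sum.\<close>

definition past_mean :: "nat \<Rightarrow> nat \<Rightarrow> 'a \<Rightarrow> real" where
  "past_mean t s \<omega> = g s \<bullet> (A s + (\<Sum>r=1..t. B s r *v eps r \<omega>))"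

definition future_noise :: "nat \<Rightarrow> nat \<Rightarrow> 'a \<Rightarrow> real" where
  "future_noise t s \<omega> = (\<Sum>r=t+1..s. (g s v* B s r) \<bullet> eps r \<omega>)"

text \<open>The exposure of \<open>X\<^sub>r + \<dots> + X\<^sub>T\<close> to \<open>eps\<^sub>r\<close>; its norm is \<open>\<sigma>\<^sub>r\<close>.\<close>

definition loading :: "nat \<Rightarrow> real ^ 'n" where
  "loading r = (\<Sum>u=r..T. g u v* B u r)"

lemma inner_matrix_vector: "g u \<bullet> (B u s *v x) = (g u v* B u s) \<bullet> x"
  by (simp add: dot_lmul_matrix)

lemma X_eq: "t \<le> s \<Longrightarrow> X s \<omega> = past_mean t s \<omega> + future_noise t s \<omega>"
proof -
  assume "t \<le> s"
  then have "{1..s} = {1..t} \<union> {t+1..s}" by auto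
  then have "(\<Sum>r=1..s. B s r *v eps r \<omega>) = (\<Sum>r=1..t. B s r *v eps r \<omega>) + (\<Sum>r=t+1..s. B s r *v eps r \<omega>)"
    by (simp only:) (rule sum.union_disjoint, auto)
  then show ?thesis
    by (simp add: gauss_process_def past_mean_def future_noise_def inner_add_right inner_sum_right inner_matrix_vector)
qed

lemma past_mean_Suc:
  "past_mean (Suc t) s \<omega> = past_mean t s \<omega> + (g s v* B s (Suc t)) \<bullet> eps (Suc t) \<omega>"
  by (simp add: past_mean_def inner_add_right inner_matrix_vector)

lemma measurable_past_mean: "t \<le> T \<Longrightarrow> past_mean t s \<in> borel_measurable (F t)"
proof -
  assume "t \<le> T"
  then have [measurable]: "eps r \<in> borel_measurable (F t)" if "r \<in> {1..t}" for r
    using that by (intro measurable_eps_F) auto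
  show ?thesis unfolding past_mean_def[abs_def] by measurable
qed

lemma measurable_future_noise: "s \<le> T \<Longrightarrow> future_noise t s \<in> borel_measurable (H t)"
proof -
  assume "s \<le> T"
  then have [measurable]: "eps r \<in> borel_measurable (H t)" if "r \<in> {t+1..s}" for r
    using that by (intro measurable_eps_H) auto
  show ?thesis unfolding future_noise_def[abs_def] by measurable
qed

lemma integrable_inner_eps: "r \<in> {1..T} \<Longrightarrow> integrable P (\<lambda>\<omega>. b \<bullet> eps r \<omega>)"
  by (rule std_normal_vector_inner_integrable[OF eps_normal])

lemma Q_inner_eps:
  assumes "r \<in> {1..T}"
  shows "integrable Q (\<lambda>\<omega>. b \<bullet> eps r \<omega>)" "Q.expectation (\<lambda>\<omega>. b \<bullet> eps r \<omega>) = b \<bullet> lam r"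
proof -
  have m: "(\<lambda>x. b \<bullet> x) \<in> borel_measurable borel" by measurable
  show "integrable Q (\<lambda>\<omega>. b \<bullet> eps r \<omega>)" "Q.expectation (\<lambda>\<omega>. b \<bullet> eps r \<omega>) = b \<bullet> lam r"
    using integrable_inner_eps[OF assms, of b] std_normal_vector_inner_integrable(2)[OF eps_normal[OF assms], of b]
    by (simp_all add: Q_eps[OF assms m] inner_add_right prob_space)
qed

lemma integrable_past_mean:
  assumes "t \<le> T" shows "integrable P (past_mean t s)" "integrable Q (past_mean t s)"
  using assms unfolding past_mean_def[abs_def] inner_add_right inner_sum_right inner_matrix_vector
  by (auto intro!: Bochner_Integration.integrable_add Bochner_Integration.integrable_sum integrable_inner_eps Q_inner_eps)

lemma integrable_future_noise:
  assumes "s \<le> T" shows "integrable P (future_noise t s)" "integrable Q (future_noise t s)"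
  using assms unfolding future_noise_def[abs_def]
  by (auto intro!: Bochner_Integration.integrable_sum integrable_inner_eps Q_inner_eps)

lemma expectation_future_noise:
  assumes "s \<le> T"
  shows "expectation (future_noise t s) = 0"
    and "Q.expectation (future_noise t s) = (\<Sum>r=t+1..s. g s \<bullet> (B s r *v lam r))"
proof -
  show "expectation (future_noise t s) = 0"
    unfolding future_noise_def[abs_def] using assms
    by (subst Bochner_Integration.integral_sum)
      (auto intro!: sum.neutral simp: integrable_inner_eps std_normal_vector_inner_integrable(2)[OF eps_normal])
  show "Q.expectation (future_noise t s) = (\<Sum>r=t+1..s. g s \<bullet> (B s r *v lam r))"
    unfolding future_noise_def[abs_def] using assms
    by (subst Bochner_Integration.integral_sum)
      (auto intro!: sum.cong simp: Q_inner_eps inner_matrix_vector)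
qed

lemma cond_exp_X:
  assumes "t \<le> s" "s \<le> T"
  shows "AE \<omega> in P. real_cond_exp P (F t) (X s) \<omega> = past_mean t s \<omega>"
    and "AE \<omega> in P. real_cond_exp Q (F t) (X s) \<omega> = past_mean t s \<omega> + (\<Sum>r=t+1..s. g s \<bullet> (B s r *v lam r))"
proof -
  have t: "t \<le> T" using assms by simp
  have X: "X s = (\<lambda>\<omega>. past_mean t s \<omega> + future_noise t s \<omega>)"
    using X_eq[OF assms(1)] by blast
  show "AE \<omega> in P. real_cond_exp P (F t) (X s) \<omega> = past_mean t s \<omega>"
    using real_cond_exp_add_indep[OF F_subalgebra[OF t] H_subalgebra indep_F_H[OF t] measurable_past_mean[OF t]
        integrable_past_mean(1)[OF t] measurable_future_noise[OF assms(2)] integrable_future_noise(1)[OF assms(2)]]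
    unfolding X expectation_future_noise(1)[OF assms(2)] by simp
  show "AE \<omega> in P. real_cond_exp Q (F t) (X s) \<omega> = past_mean t s \<omega> + (\<Sum>r=t+1..s. g s \<bullet> (B s r *v lam r))"
    using Q.real_cond_exp_add_indep[OF F_subalgebra_Q[OF t] H_subalgebra_Q Q_indep_F_H[OF t] measurable_past_mean[OF t]
        integrable_past_mean(2)[OF t] measurable_future_noise[OF assms(2)] integrable_future_noise(2)[OF assms(2)]]
    \<comment> \<open>The identity is proved almost surely under \<open>Q\<close>; positivity of the
      density carries it over to \<open>P\<close>.\<close>
    unfolding X expectation_future_noise(2)[OF assms(2)] by (rule AE_Q_imp_AE_P)
qed

section \<open>Aggregated future payoffs and their conditional variances\<close>

lemma norm_loading: "norm (loading s) = sqrt (\<Sum>j=s..T. \<Sum>k=s..T. g j \<bullet> ((B j s ** transpose (B k s)) *v g k))"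
proof -
  have "g j \<bullet> ((B j s ** transpose (B k s)) *v g k) = (g j v* B j s) \<bullet> (g k v* B k s)" for j k
    by (simp add: matrix_vector_mul_assoc[symmetric] inner_matrix_vector)
  then show ?thesis
    unfolding norm_eq_sqrt_inner loading_def inner_sum_left unfolding inner_sum_right by simp
qed

lemma loading_inner: "loading s \<bullet> x = (\<Sum>u=s..T. g u \<bullet> (B u s *v x))"
  by (simp add: loading_def inner_sum_left inner_matrix_vector)

definition total_past_mean :: "nat \<Rightarrow> 'a \<Rightarrow> real" where
  "total_past_mean t \<omega> = (\<Sum>s=t+1..T. past_mean t s \<omega>)"

definition total_future_noise :: "nat \<Rightarrow> 'a \<Rightarrow> real" where
  "total_future_noise t \<omega> = (\<Sum>r=t+1..T. loading r \<bullet> eps r \<omega>)"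

lemma total_past_mean_T: "total_past_mean T \<omega> = 0"
  by (simp add: total_past_mean_def)

text \<open>At time \<open>t + 1\<close> the payoff \<open>X (Suc t)\<close> equals its own past
  mean, so the left side is the full sum of past means at \<open>t + 1\<close>. Going back to
  \<open>t\<close> removes the effect of \<open>eps (Suc t)\<close> on each later payoff, and these
  effects add up to the loading.\<close>

lemma X_plus_total_past_mean:
  assumes "t < T"
  shows "X (Suc t) \<omega> + total_past_mean (Suc t) \<omega> = total_past_mean t \<omega> + loading (Suc t) \<bullet> eps (Suc t) \<omega>"
proof -
  have "X (Suc t) \<omega> = past_mean (Suc t) (Suc t) \<omega>"
    by (simp add: X_eq[of "Suc t"] future_noise_def)
  then have "X (Suc t) \<omega> + total_past_mean (Suc t) \<omega> = (\<Sum>s=Suc t..T. past_mean (Suc t) s \<omega>)"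
    using assms by (simp add: total_past_mean_def sum.atLeast_Suc_atMost)
  also have "\<dots> = total_past_mean t \<omega> + loading (Suc t) \<bullet> eps (Suc t) \<omega>"
    by (simp add: past_mean_Suc sum.distrib total_past_mean_def loading_inner inner_matrix_vector)
  finally show ?thesis .
qed

lemma sum_X_eq: "(\<Sum>u=t+1..T. X u \<omega>) = total_past_mean t \<omega> + total_future_noise t \<omega>"
proof -
  have "(\<Sum>u=t+1..T. X u \<omega>) = total_past_mean t \<omega> + (\<Sum>u=t+1..T. \<Sum>r=t+1..u. (g u v* B u r) \<bullet> eps r \<omega>)"
    unfolding total_past_mean_def sum.distrib[symmetric]
    by (rule sum.cong) (auto simp: X_eq[of t] future_noise_def)
  \<comment> \<open>The double sum runs over a triangle; summing first over the payoff dates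
    collects the total coefficient of each noise vector.\<close>
  also have "(\<Sum>u=t+1..T. \<Sum>r=t+1..u. (g u v* B u r) \<bullet> eps r \<omega>) = (\<Sum>r=t+1..T. \<Sum>u=r..T. (g u v* B u r) \<bullet> eps r \<omega>)"
    by (subst sum.Sigma, simp, simp, subst sum.Sigma, simp, simp)
      (rule sum.reindex_bij_witness[of _ "\<lambda>(r,u). (u,r)" "\<lambda>(u,r). (r,u)"], auto)
  finally show ?thesis
    by (simp add: total_future_noise_def loading_inner inner_matrix_vector)
qed

lemma measurable_total_past_mean: "t \<le> T \<Longrightarrow> total_past_mean t \<in> borel_measurable (F t)"
  unfolding total_past_mean_def[abs_def] by (intro borel_measurable_sum measurable_past_mean)

lemma integrable_total_past_mean: "t \<le> T \<Longrightarrow> integrable P (total_past_mean t)"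
  unfolding total_past_mean_def[abs_def] by (intro Bochner_Integration.integrable_sum integrable_past_mean)

lemma measurable_total_future_noise: "total_future_noise t \<in> borel_measurable (H t)"
proof -
  have [measurable]: "eps r \<in> borel_measurable (H t)" if "r \<in> {t+1..T}" for r
    using that by (intro measurable_eps_H) auto
  show ?thesis unfolding total_future_noise_def[abs_def] by measurable
qed

lemma total_future_noise_integrable: "integrable P (total_future_noise t)"
  unfolding total_future_noise_def[abs_def]
  by (intro Bochner_Integration.integrable_sum integrable_inner_eps) auto

lemma expectation_total_future_noise: "expectation (total_future_noise t) = 0"
  unfolding total_future_noise_def[abs_def]
  by (subst Bochner_Integration.integral_sum)
      (auto intro!: sum.neutral simp: integrable_inner_eps std_normal_vector_inner_integrable(2)[OF eps_normal])

text \<open>Backward induction peeling off the earliest noise term: it is independent of the later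
  ones and centred, so the cross term has mean zero and variances add.\<close>

lemma total_future_noise_square:
  assumes "t \<le> T"
  shows "integrable P (\<lambda>\<omega>. (total_future_noise t \<omega>)\<^sup>2) \<and>
    expectation (\<lambda>\<omega>. (total_future_noise t \<omega>)\<^sup>2) = (\<Sum>r=t+1..T. (norm (loading r))\<^sup>2)"
  using assms
proof (induction t rule: inc_induct)
  case base
  then show ?case by (simp add: total_future_noise_def)
next
  case (step t)
  let ?W = "\<lambda>\<omega>. loading (Suc t) \<bullet> eps (Suc t) \<omega>" and ?U = "total_future_noise (Suc t)"
  have t: "Suc t \<in> {1..T}" "Suc t \<le> T" using step by auto
  note W = std_normal_vector_inner_integrable[OF eps_normal[OF t(1)], of "loading (Suc t)"]
  have [measurable]: "eps (Suc t) \<in> borel_measurable (F (Suc t))"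
    using t by (intro measurable_eps_F) auto
  have ind: "indep_var borel ?W borel ?U"
    by (rule indep_var_indep_set[OF F_subalgebra[OF t(2)] H_subalgebra indep_F_H[OF t(2)] _ measurable_total_future_noise])
      measurable
  note WU = indep_var_integrable[OF ind W(1) total_future_noise_integrable]
    indep_var_lebesgue_integral[OF ind W(1) total_future_noise_integrable]
  have sq: "(total_future_noise t \<omega>)\<^sup>2 = (?W \<omega>)\<^sup>2 + 2 * (?W \<omega> * ?U \<omega>) + (?U \<omega>)\<^sup>2" for \<omega>
    using t(2) by (simp add: total_future_noise_def sum.atLeast_Suc_atMost[of "Suc t"] power2_sum)
  show ?case
    unfolding sq using W WU step.IH t(2)
    by (simp add: sum.atLeast_Suc_atMost[of "Suc t"])
qed

text \<open>Each conditional variance is the constant sum of the squared loadings still to come.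
  Advancing from \<open>s - 1\<close> to \<open>s\<close> removes exactly the term of period
  \<open>s\<close>.\<close>

lemma cond_var_sum_X:
  assumes s: "s \<in> {1..T}"
  shows "AE \<omega> in P. (norm (loading s))\<^sup>2 =
    cond_var P (F (s - 1)) (\<lambda>\<omega>'. \<Sum>u=s..T. X u \<omega>') \<omega> - cond_var P (F s) (\<lambda>\<omega>'. \<Sum>u=s..T. X u \<omega>') \<omega>"
proof -
  obtain t where t: "s = Suc t" "t \<le> T" "s \<le> T" using s by (cases s) auto
  have m: "X s \<in> borel_measurable (F s)" "integrable P (X s)"
  proof -
    have "X s = past_mean s s" by (simp add: fun_eq_iff X_eq[of s] future_noise_def)
    then show "X s \<in> borel_measurable (F s)" "integrable P (X s)"
      using measurable_past_mean[OF t(3), of s] integrable_past_mean(1)[OF t(3), of s] by simp_all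
  qed
  note U = measurable_total_future_noise total_future_noise_integrable expectation_total_future_noise
    total_future_noise_square[THEN conjunct1]
  have "AE \<omega> in P. cond_var P (F t) (\<lambda>\<omega>'. \<Sum>u=s..T. X u \<omega>') \<omega> = expectation (\<lambda>\<omega>. (total_future_noise t \<omega>)\<^sup>2)"
  proof (rule cond_var_add_indep[OF F_subalgebra[OF t(2)] H_subalgebra indep_F_H[OF t(2)]])
    show "(\<Sum>u=s..T. X u \<omega>) = total_past_mean t \<omega> + total_future_noise t \<omega>" for \<omega>
      using sum_X_eq[of \<omega> t] t(1) by simp
  qed (use t U measurable_total_past_mean integrable_total_past_mean in auto)
  moreover have "AE \<omega> in P. cond_var P (F s) (\<lambda>\<omega>'. \<Sum>u=s..T. X u \<omega>') \<omega> = expectation (\<lambda>\<omega>. (total_future_noise s \<omega>)\<^sup>2)"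
  proof (rule cond_var_add_indep[OF F_subalgebra[OF t(3)] H_subalgebra indep_F_H[OF t(3)]])
    \<comment> \<open>At time \<open>s\<close> the payoff \<open>X s\<close> is already known, so it
      joins the measurable part and leaves the variance unchanged.\<close>
    show "(\<lambda>\<omega>. X s \<omega> + total_past_mean s \<omega>) \<in> borel_measurable (F s)"
      using m(1) measurable_total_past_mean[OF t(3)] by measurable
    show "integrable P (\<lambda>\<omega>. X s \<omega> + total_past_mean s \<omega>)"
      using m(2) integrable_total_past_mean[OF t(3)] by simp
    show "(\<Sum>u=s..T. X u \<omega>) = X s \<omega> + total_past_mean s \<omega> + total_future_noise s \<omega>" for \<omega>
      using sum_X_eq[of \<omega> s] t(3) by (simp add: sum.atLeast_Suc_atMost)
  qed (use t U in auto)
  ultimately show ?thesis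
    by eventually_elim
      (use t in \<open>simp add: total_future_noise_square sum.atLeast_Suc_atMost[of "Suc t"]\<close>)
qed

section \<open>One step of the backward recursion\<close>

lemma normal_call_expectation:
  fixes e1 :: "'a \<Rightarrow> real" and r :: real
  assumes e1: "distributed P lborel e1 (\<lambda>x. ennreal (std_normal_density x))" and s: "s \<in> {1..T}"
  shows "integrable Q (\<lambda>\<omega>. max 0 (r - loading s \<bullet> eps s \<omega>))"
    and "Q.expectation (\<lambda>\<omega>. max 0 (r - loading s \<bullet> eps s \<omega>))
      = expectation (\<lambda>\<omega>. max 0 (r - norm (loading s) * e1 \<omega> - loading s \<bullet> lam s))"
proof -
  note [measurable] = measurable_eps[OF s]
  have [measurable]: "e1 \<in> borel_measurable P" using e1 by (simp add: distributed_def)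
  let ?f = "\<lambda>x. max 0 (r - x - loading s \<bullet> lam s)"
  have m: "(\<lambda>x. max 0 (r - loading s \<bullet> x)) \<in> borel_measurable borel" by measurable
  have int: "integrable P (\<lambda>\<omega>. ?f (loading s \<bullet> eps s \<omega>))"
    using integrable_inner_eps[OF s, of "loading s"] by auto
  have eq: "max 0 (r - loading s \<bullet> (eps s \<omega> + lam s)) = ?f (loading s \<bullet> eps s \<omega>)" for \<omega>
    by (simp add: inner_add_right algebra_simps)
  show "integrable Q (\<lambda>\<omega>. max 0 (r - loading s \<bullet> eps s \<omega>))"
    unfolding Q_eps(1)[OF s m] eq by (rule int)
  have e1_law: "distr P borel e1 = std_normal_distribution"
    using distributed_distr_eq_density[OF e1] by (simp cong: distr_cong)
  \<comment> \<open>First the noise is replaced by its shifted version under \<open>P\<close>; then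
    the linear form is replaced by the multiple \<open>norm (loading s)\<close> of
    \<open>e1\<close>, which has the same law. Only the law of \<open>e1\<close> enters, not its
    joint law with the noise.\<close>
  have "Q.expectation (\<lambda>\<omega>. max 0 (r - loading s \<bullet> eps s \<omega>)) = expectation (\<lambda>\<omega>. ?f (loading s \<bullet> eps s \<omega>))"
    unfolding Q_eps(2)[OF s m] eq ..
  also have "\<dots> = integral\<^sup>L (distr P borel (\<lambda>\<omega>. loading s \<bullet> eps s \<omega>)) ?f"
    by (subst integral_distr) auto
  also have "\<dots> = integral\<^sup>L std_normal_distribution (\<lambda>x. ?f (norm (loading s) * x))"
    unfolding std_normal_vector_inner_law[OF eps_normal[OF s]] by (subst integral_distr) auto
  also have "\<dots> = expectation (\<lambda>\<omega>. ?f (norm (loading s) * e1 \<omega>))"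
    unfolding e1_law[symmetric] by (subst integral_distr) auto
  finally show "Q.expectation (\<lambda>\<omega>. max 0 (r - loading s \<bullet> eps s \<omega>))
      = expectation (\<lambda>\<omega>. max 0 (r - norm (loading s) * e1 \<omega> - loading s \<bullet> lam s))" .
qed

text \<open>The engine of the induction: if the next value is the total past mean plus a constant,
  the risk measure adds only a multiple of \<open>r0\<close>, the past mean cancels inside the
  positive part, and what remains depends on \<open>eps (Suc t)\<close> alone.\<close>

lemma risk_step:
  fixes M :: "real measure" and V :: "'a \<Rightarrow> real" and k :: real
  assumes M: "admissible_quantile_weight M" and t: "t < T"
    and V_meas: "V \<in> borel_measurable (F (Suc t))"
    and V: "AE \<omega> in P. V \<omega> = total_past_mean (Suc t) \<omega> + k"
    and e1: "distributed P lborel e1 (\<lambda>x. ennreal (std_normal_density x))"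
  defines "R \<equiv> quantile_risk P M (F t) (\<lambda>\<omega>. - X (Suc t) \<omega> - V \<omega>)"
    and "r0 \<equiv> \<integral>u. inv (cdf std_normal_distribution) u \<partial>M"
  shows "AE \<omega> in P. R \<omega> = total_past_mean t \<omega> + k + norm (loading (Suc t)) * r0"
    and "AE \<omega> in P. real_cond_exp Q (F t) (\<lambda>\<omega>. max 0 (R \<omega> - X (Suc t) \<omega> - V \<omega>)) \<omega>
      = expectation (\<lambda>\<omega>. max 0 (norm (loading (Suc t)) * r0 - norm (loading (Suc t)) * e1 \<omega> - loading (Suc t) \<bullet> lam (Suc t)))"
proof -
  let ?W = "\<lambda>\<omega>. loading (Suc t) \<bullet> eps (Suc t) \<omega>" and ?r = "norm (loading (Suc t)) * r0"
  have t': "t \<le> T" "Suc t \<in> {1..T}" "Suc t \<in> {t+1..T}" "Suc t \<le> T" using t by auto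
  have W_meas: "?W \<in> borel_measurable (H t)"
    using measurable_eps_H[OF t'(3)] by measurable
  have sub: "N \<in> borel_measurable (F s) \<Longrightarrow> s \<le> T \<Longrightarrow> N \<in> borel_measurable (F T)" for N :: "'a \<Rightarrow> real" and s
    using F_mono[of s T] by (auto intro: measurable_from_subalg[rotated] simp: subalgebra_def)
  have G_F: "X (Suc t) \<in> borel_measurable (F T)"
    using measurable_G_F[of "Suc t" T] t'(2) by measurable
  have [measurable]: "V \<in> borel_measurable P" "X (Suc t) \<in> borel_measurable P"
    using measurable_from_subalg[OF F_subalgebra[OF t'(4)] V_meas]
      measurable_from_subalg[OF F_subalgebra[OF order_refl] G_F] by auto
  have Z: "AE \<omega> in P. - (- X (Suc t) \<omega> - V \<omega>) = (total_past_mean t \<omega> + k) + ?W \<omega>"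
    using V
  proof eventually_elim
    case (elim \<omega>)
    then show ?case using X_plus_total_past_mean[OF t, of \<omega>] by simp
  qed
  have R: "R \<in> borel_measurable (F t)" "AE \<omega> in P. R \<omega> = total_past_mean t \<omega> + k + ?r"
    unfolding R_def r0_def
    using quantile_risk_normal[OF F_subalgebra[OF t'(1)] H_subalgebra indep_F_H[OF t'(1)] _ W_meas
        std_normal_vector_inner_law[OF eps_normal[OF t'(2)]] norm_ge_zero _ Z M]
      measurable_total_past_mean[OF t'(1)] by simp_all
  show "AE \<omega> in P. R \<omega> = total_past_mean t \<omega> + k + ?r" by (rule R(2))
  let ?f = "\<lambda>\<omega>. max 0 (R \<omega> - X (Suc t) \<omega> - V \<omega>)" and ?f' = "\<lambda>\<omega>. max 0 (?r - ?W \<omega>)"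
  have W_F: "?W \<in> borel_measurable (F T)"
    using measurable_eps_F[OF _ t'(4) order_refl] by measurable
  note [measurable] = sub[OF R(1) t'(1)] sub[OF V_meas t'(4)] G_F W_F
  have AE_P: "AE \<omega> in P. ?f \<omega> = ?f' \<omega>"
    using R(2) Z by eventually_elim simp
  \<comment> \<open>To replace the integrand inside a \<open>Q\<close>-conditional expectation, the
    \<open>P\<close>-almost sure equality must become a \<open>Q\<close>-almost sure one. This uses
    that \<open>R\<close> and \<open>V\<close> are measurable for the filtration.\<close>
  have set: "{\<omega>\<in>space P. ?f \<omega> = ?f' \<omega>} \<in> sets (F T)"
  proof -
    have "{\<omega>\<in>space (F T). ?f \<omega> = ?f' \<omega>} \<in> sets (F T)" by measurable
    then show ?thesis by simp
  qed
  interpret SQ: sigma_finite_subalgebra Q "F t"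
    by (rule Q.sigma_finite_subalgebraI[OF F_subalgebra_Q[OF t'(1)]])
  have "AE \<omega> in Q. real_cond_exp Q (F t) ?f \<omega> = real_cond_exp Q (F t) ?f' \<omega>"
    by (rule SQ.real_cond_exp_cong[OF AE_P_imp_AE_Q[OF set AE_P]])
      (simp_all add: measurable_cong_sets[OF sets_Q refl])
  moreover have "AE \<omega> in Q. real_cond_exp Q (F t) ?f' \<omega> = Q.expectation ?f'"
  proof (rule Q.real_cond_exp_indep[OF F_subalgebra_Q[OF t'(1)] H_subalgebra_Q Q_indep_F_H[OF t'(1)]])
    show "?f' \<in> borel_measurable (H t)"
      using measurable_eps_H[OF t'(3)] by measurable
  qed (rule normal_call_expectation(1)[OF e1 t'(2)])
  ultimately have "AE \<omega> in Q. real_cond_exp Q (F t) ?f \<omega> = Q.expectation ?f'"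
    by eventually_elim simp
  then show "AE \<omega> in P. real_cond_exp Q (F t) ?f \<omega>
      = expectation (\<lambda>\<omega>. max 0 (?r - norm (loading (Suc t)) * e1 \<omega> - loading (Suc t) \<bullet> lam (Suc t)))"
    unfolding normal_call_expectation(2)[OF e1 t'(2)] by (rule AE_Q_imp_AE_P)
qed

end

section \<open>Backward induction and identification of the constants\<close>

theorem theorem9:
  fixes P :: "'a measure"
    and T :: nat
    and eps :: "nat \<Rightarrow> 'a \<Rightarrow> real ^ 'n"
    and A lam g :: "nat \<Rightarrow> real ^ 'n"
    and B :: "nat \<Rightarrow> nat \<Rightarrow> real ^ 'n ^ 'n"
    and M :: "real measure"
    and V :: "nat \<Rightarrow> 'a \<Rightarrow> real"
    and e1 :: "'a \<Rightarrow> real"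
  defines "G \<equiv> gauss_process A B eps"
  defines "F \<equiv> generated_filtration P G"
  defines "Q \<equiv> measure_change P (F T) (density_process lam eps T)"
  defines "X \<equiv> (\<lambda>t \<omega>. g t \<bullet> G t \<omega>)"
  defines "\<rho> \<equiv> (\<lambda>t. quantile_risk P M (F t))"
  defines "R \<equiv> (\<lambda>t. \<rho> t (\<lambda>\<omega>. - X (t + 1) \<omega> - V (t + 1) \<omega>))"
  defines "r0 \<equiv> (\<integral>u. inv (cdf std_normal_distribution) u \<partial>M)"
  defines "\<sigma> \<equiv> (\<lambda>s. sqrt (\<Sum>j=s..T. \<Sum>k=s..T.
             g j \<bullet> ((B j s ** transpose (B k s)) *v g k)))"
  defines "h \<equiv> (\<lambda>s. \<Sum>u=s..T. g u \<bullet> (B u s *v lam s))"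
  defines "c \<equiv> (\<lambda>s. prob_space.expectation P
             (\<lambda>\<omega>. max 0 (\<sigma> s * (r0 - e1 \<omega>) - h s)))"
  defines "KQ \<equiv> (\<lambda>t. \<Sum>s=t+1..T. \<sigma> s * r0 - h s - c s)"
  defines "KP \<equiv> (\<lambda>t. \<Sum>s=t+1..T. \<sigma> s * r0 - c s)"
  assumes model: "gaussian_model P T eps B"
    and M: "admissible_quantile_weight M"
    and e1: "distributed P lborel e1 (\<lambda>x. ennreal (std_normal_density x))"
    and V_adapted: "\<And>t. t \<le> T \<Longrightarrow> V t \<in> borel_measurable (F t)"
    and V_terminal: "AE \<omega> in P. V T \<omega> = 0"
    and V_rec: "\<And>t. t < T \<Longrightarrow> AE \<omega> in P. V t \<omega> =
      R t \<omega> - real_cond_exp Q (F t) (\<lambda>\<omega>'. max 0 (R t \<omega>' - X (t + 1) \<omega>' - V (t + 1) \<omega>')) \<omega>"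
  shows "(\<forall>t<T. AE \<omega> in P. V t \<omega> =
            (\<Sum>s=t+1..T. real_cond_exp Q (F t) (X s) \<omega>) + KQ t)
       \<and> (\<forall>t<T. AE \<omega> in P. V t \<omega> =
            (\<Sum>s=t+1..T. real_cond_exp P (F t) (X s) \<omega>) + KP t)
       \<and> (\<forall>s\<in>{1..T}. 0 \<le> \<sigma> s
            \<and> (\<sigma> s)\<^sup>2 = (\<Sum>j=s..T. \<Sum>k=s..T. g j \<bullet> ((B j s ** transpose (B k s)) *v g k))
            \<and> (AE \<omega> in P. (\<sigma> s)\<^sup>2 =
                 cond_var P (F (s - 1)) (\<lambda>\<omega>'. \<Sum>u=s..T. X u \<omega>') \<omega>
                 - cond_var P (F s) (\<lambda>\<omega>'. \<Sum>u=s..T. X u \<omega>') \<omega>))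
       \<and> (\<forall>t<T. AE \<omega> in P. R t \<omega> - V t \<omega> = c (t + 1))"
proof -
  interpret gm: gaussian_market P T eps B A lam g
    using model by (simp add: gaussian_market_def)
  note market_defs = G_def F_def Q_def X_def \<rho>_def
  have \<sigma>_eq: "\<sigma> s = norm (gm.loading s)" for s
    by (simp add: \<sigma>_def gm.norm_loading)
  have h_eq: "h s = gm.loading s \<bullet> lam s" for s
    by (simp add: h_def gm.loading_inner)
  have c_eq: "c s = gm.expectation (\<lambda>\<omega>. max 0 (norm (gm.loading s) * r0 - norm (gm.loading s) * e1 \<omega> - gm.loading s \<bullet> lam s))" for s
    by (simp add: c_def \<sigma>_eq h_eq right_diff_distrib)
  have KP_Suc: "KP t = KP (Suc t) + \<sigma> (Suc t) * r0 - c (Suc t)" if "t < T" for t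
    using that by (simp add: KP_def sum.atLeast_Suc_atMost[of "Suc t"])
  have R_eq: "AE \<omega> in P. R t \<omega> = gm.total_past_mean t \<omega> + KP (Suc t) + \<sigma> (Suc t) * r0"
    and C_eq: "AE \<omega> in P. real_cond_exp Q (F t) (\<lambda>\<omega>'. max 0 (R t \<omega>' - X (t + 1) \<omega>' - V (t + 1) \<omega>')) \<omega> = c (Suc t)"
    if t: "t < T" and V: "AE \<omega> in P. V (Suc t) \<omega> = gm.total_past_mean (Suc t) \<omega> + KP (Suc t)" for t
    using gm.risk_step[OF M t V_adapted[of "Suc t", unfolded market_defs] V e1] t
    unfolding R_def market_defs \<sigma>_eq c_eq r0_def by simp_all
  \<comment> \<open>The induction runs down from \<open>T\<close>, where both the past mean and the
    constant are empty sums. Including \<open>T\<close> also supplies the hypothesis of the last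
    step at \<open>t = T - 1\<close>.\<close>
  have V_P: "AE \<omega> in P. V t \<omega> = gm.total_past_mean t \<omega> + KP t" if "t \<le> T" for t
    using that
  proof (induction t rule: inc_induct)
    case base
    show ?case using V_terminal by (simp add: gm.total_past_mean_T KP_def)
  next
    case (step t)
    from V_rec[OF step.hyps(2)] R_eq[OF step.hyps(2) step.IH] C_eq[OF step.hyps(2) step.IH]
    show ?case
      by eventually_elim (simp add: KP_Suc[OF step.hyps(2)])
  qed
  \<comment> \<open>The two constants differ by the total drift of the noise under \<open>Q\<close>.
    Exchanging the triangular sums turns the drifts of the individual payoffs into the sum of the
    \<open>h r\<close>.\<close>
  have KQ_eq: "KP t = (\<Sum>s=t+1..T. \<Sum>r=t+1..s. g s \<bullet> (B s r *v lam r)) + KQ t" for t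
  proof -
    have "(\<Sum>s=t+1..T. \<Sum>r=t+1..s. g s \<bullet> (B s r *v lam r)) = (\<Sum>r=t+1..T. h r)"
      unfolding h_def
      by (subst sum.Sigma, simp, simp, subst sum.Sigma, simp, simp)
        (rule sum.reindex_bij_witness[of _ "\<lambda>(r,u). (u,r)" "\<lambda>(u,r). (r,u)"], auto)
    then show ?thesis
      by (simp add: KP_def KQ_def sum_subtractf)
  qed
  have "AE \<omega> in P. V t \<omega> = (\<Sum>s=t+1..T. real_cond_exp Q (F t) (X s) \<omega>) + KQ t" if t: "t < T" for t
  proof -
    have "AE \<omega> in P. \<forall>s\<in>{t+1..T}. real_cond_exp Q (F t) (X s) \<omega>
        = gm.past_mean t s \<omega> + (\<Sum>r=t+1..s. g s \<bullet> (B s r *v lam r))"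
      unfolding market_defs by (intro AE_finite_allI gm.cond_exp_X) auto
    with V_P[OF less_imp_le[OF t]] show ?thesis
      by eventually_elim (simp add: gm.total_past_mean_def KQ_eq sum.distrib)
  qed
  moreover have "AE \<omega> in P. V t \<omega> = (\<Sum>s=t+1..T. real_cond_exp P (F t) (X s) \<omega>) + KP t" if t: "t < T" for t
  proof -
    have "AE \<omega> in P. \<forall>s\<in>{t+1..T}. real_cond_exp P (F t) (X s) \<omega> = gm.past_mean t s \<omega>"
      unfolding market_defs by (intro AE_finite_allI gm.cond_exp_X) auto
    with V_P[OF less_imp_le[OF t]] show ?thesis
      by eventually_elim (simp add: gm.total_past_mean_def)
  qed
  moreover have "0 \<le> \<sigma> s" "(\<sigma> s)\<^sup>2 = (\<Sum>j=s..T. \<Sum>k=s..T. g j \<bullet> ((B j s ** transpose (B k s)) *v g k))" for s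
  proof -
    show nonneg: "0 \<le> \<sigma> s" by (simp add: \<sigma>_eq)
    then show "(\<sigma> s)\<^sup>2 = (\<Sum>j=s..T. \<Sum>k=s..T. g j \<bullet> ((B j s ** transpose (B k s)) *v g k))"
      unfolding \<sigma>_def real_sqrt_ge_0_iff by (rule real_sqrt_pow2)
  qed
  moreover have "AE \<omega> in P. (\<sigma> s)\<^sup>2 = cond_var P (F (s - 1)) (\<lambda>\<omega>'. \<Sum>u=s..T. X u \<omega>') \<omega>
      - cond_var P (F s) (\<lambda>\<omega>'. \<Sum>u=s..T. X u \<omega>') \<omega>" if "s \<in> {1..T}" for s
    using gm.cond_var_sum_X[OF that] unfolding market_defs \<sigma>_eq .
  moreover have "AE \<omega> in P. R t \<omega> - V t \<omega> = c (t + 1)" if t: "t < T" for t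
  proof -
    have "AE \<omega> in P. V (Suc t) \<omega> = gm.total_past_mean (Suc t) \<omega> + KP (Suc t)"
      using t by (intro V_P) simp
    \<comment> \<open>By the recursion \<open>R t - V t\<close> is exactly the conditional
      expectation of the positive part, already identified with the constant.\<close>
    from V_rec[OF t] C_eq[OF t this] show ?thesis
      by eventually_elim simp
  qed
  ultimately show ?thesis by blast
qed

end
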